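(* (a) For every real $\alpha<1$ there exists an integer-valued stochastic process $S=\{S_n\}_{n\ge 0}$ such that $|S_n-S_{n-1}|=1$ almost surely for all $n\ge 1$, and such that for some constant $C_\alpha<\infty$ the predictability profile of $S$ satisfies $$\mathrm{PRE}_S(k)\le C_\alpha k^{-\alpha}\quad\text{for all } k\ge 1 .$$ (b) Furthermore, for every real $\alpha<1$ there exists a process $S$ with all the properties in (a) for which, in addition, the $\pm1$-valued increments $\{S_n-S_{n-1}\}_{n\ge1}$ form a stationary ergodic process.
   Context: For a sequence of random variables $S=\{S_n\}_{n\ge0}$ taking values in a countable set $V$, its predictability profile $\{\mathrm{PRE}_S(k)\}_{k\ge1}$ is defined by $$\mathrm{PRE}_S(k)=\sup \mathbf{P}[S_{n+k}=x\mid S_0,\ldots,S_n],$$ where the supremum is over all $x\in V$, all $n\ge0$, and all histories $S_0,\ldots,S_n$ (that is, all values $(s_0,\dots,s_n)$ attained by $(S_0,\dots,S_n)$ with positive probability). *)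

theory Defs
  imports "HOL-Probability.Probability"
begin

definition discrete_process :: "'a measure \<Rightarrow> (nat \<Rightarrow> 'a \<Rightarrow> 'v) \<Rightarrow> bool" where
  "discrete_process M S \<longleftrightarrow>
     prob_space M \<and> (\<forall>n. S n \<in> M \<rightarrow>\<^sub>M count_space UNIV)"

(* Only the values s 0, ..., s n of the history s matter. For a discrete process and a countable
   value type the set below is nonempty and contained in [0,1], so Sup is the actual supremum. *)
definition predictability_profile ::
    "'a measure \<Rightarrow> (nat \<Rightarrow> 'a \<Rightarrow> 'v::countable) \<Rightarrow> nat \<Rightarrow> real" where
  "predictability_profile M S k =
     Sup {cond_prob M (\<lambda>\<omega>. S (n + k) \<omega> = x) (\<lambda>\<omega>. \<forall>i\<le>n. S i \<omega> = s i) | x n s.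
            \<P>(\<omega> in M. \<forall>i\<le>n. S i \<omega> = s i) > 0}"

definition process_law :: "'a measure \<Rightarrow> (nat \<Rightarrow> 'a \<Rightarrow> 'v) \<Rightarrow> (nat \<Rightarrow> 'v) measure" where
  "process_law M X =
     distr M (\<Pi>\<^sub>M i\<in>UNIV. count_space UNIV) (\<lambda>\<omega> n. X n \<omega>)"

definition shift :: "(nat \<Rightarrow> 'v) \<Rightarrow> nat \<Rightarrow> 'v" where
  "shift x = (\<lambda>n. x (Suc n))"

definition stationary_process :: "'a measure \<Rightarrow> (nat \<Rightarrow> 'a \<Rightarrow> 'v) \<Rightarrow> bool" where
  "stationary_process M X \<longleftrightarrow> process_law M (\<lambda>n. X (Suc n)) = process_law M X"

definition ergodic_process :: "'a measure \<Rightarrow> (nat \<Rightarrow> 'a \<Rightarrow> 'v) \<Rightarrow> bool" where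
  "ergodic_process M X \<longleftrightarrow>
     (\<forall>A \<in> sets (process_law M X).
        shift -` A = A \<longrightarrow> measure (process_law M X) A \<in> {0, 1})"

definition nearest_neighbour :: "'a measure \<Rightarrow> (nat \<Rightarrow> 'a \<Rightarrow> int) \<Rightarrow> bool" where
  "nearest_neighbour M S \<longleftrightarrow> (\<forall>n\<ge>1. AE \<omega> in M. \<bar>S n \<omega> - S (n - 1) \<omega>\<bar> = 1)"

(* The increments S_n - S_(n-1), n >= 1, re-indexed to start at 0. *)
definition increments :: "(nat \<Rightarrow> 'a \<Rightarrow> int) \<Rightarrow> nat \<Rightarrow> 'a \<Rightarrow> int" where
  "increments S n \<omega> = S (Suc n) \<omega> - S n \<omega>"

(* Existence of such a walk depends only on its law, so when M and S are quantified existentially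
   it loses nothing to fix the sample points to be integer sequences, with M arbitrary. *)
definition unpredictable_walk :: "real \<Rightarrow> 'a measure \<Rightarrow> (nat \<Rightarrow> 'a \<Rightarrow> int) \<Rightarrow> bool" where
  "unpredictable_walk \<alpha> M S \<longleftrightarrow>
     discrete_process M S \<and> nearest_neighbour M S \<and>
     (\<exists>C::real. \<forall>k\<ge>1. predictability_profile M S k \<le> C * real k powr (- \<alpha>))"

end

(* Put independent uniform noise at every site and scale j, with length scale L j growing
   geometrically. At scale j each site is flagged with probability 1 / (2 L j) and carries a uniform
   value; a site i sees the value of the first flagged site of [i, i + L j). Given these values the
   increments are independent, and site i steps up with probability the sum over j of 2^-(j+1) times
   the value seen at scale j.

   If m is flagged and no other site of (m - L j, m] is, then the value V at m shifts the success
   probabilities of exactly L j increments by the common amount 2^-(j+1) V. The time that a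
   Poisson-binomial count of n variables spends at a given level, when all n probabilities increase
   at unit rate, is at most 2 / n, so the sum of the increments has atoms at most 4 * 2^j / L j.
   Within a window of about 2^j blocks of length 2 L j lying in the future, such an m exists outside
   an event of probability (5/6)^(2^j), and V is independent of the past. With L j = 2^(R j) and R
   large this beats any exponent below 1. The increments are a shift-equivariant function of the
   future noise, hence stationary, and ergodic by a zero-one law. *)

theory Submission
  imports Defs "HOL-Real_Asymp.Real_Asymp"
begin

section \<open>Independent uniform noise\<close>

definition unif :: "real measure" where
  "unif = uniform_measure lborel {0..1}"

definition noise :: "('i \<Rightarrow> real) measure" where
  "noise = (\<Pi>\<^sub>M i\<in>UNIV. unif)"

lemma prob_space_unif: "prob_space unif"
  unfolding unif_def by (rule prob_space_uniform_measure) auto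

lemma sets_unif [measurable_cong, simp]: "sets unif = sets borel"
  by (simp add: unif_def)

lemma space_unif [simp]: "space unif = UNIV"
  by (simp add: unif_def)

lemma measure_unif_lessThan: "0 \<le> a \<Longrightarrow> a \<le> 1 \<Longrightarrow> measure unif {..<a} = a"
proof -
  assume a: "0 \<le> a" "a \<le> 1"
  then have "{0..1} \<inter> {..<a} = {0..<a}" by auto
  then show ?thesis
    using a by (simp add: unif_def measure_uniform_measure)
qed

lemma nn_integral_unif:
  assumes [measurable]: "f \<in> borel_measurable borel"
  shows "(\<integral>\<^sup>+v. f v \<partial>unif) = (\<integral>\<^sup>+v. f v * indicator {0..1} v \<partial>lborel)"
  unfolding unif_def by (subst nn_integral_uniform_measure) (auto simp: divide_ennreal_def)

interpretation unif: prob_space unif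
  by (rule prob_space_unif)

interpretation noise_product: product_prob_space "\<lambda>_. unif" UNIV
  by unfold_locales

lemma prob_space_noise: "prob_space noise"
  unfolding noise_def by (rule noise_product.prob_space_axioms)

interpretation noise: prob_space noise
  by (rule prob_space_noise)

lemma space_noise [simp]: "space noise = UNIV"
  by (simp add: noise_def space_PiM)

lemma sets_noise [measurable_cong]: "sets noise = sets (\<Pi>\<^sub>M i\<in>UNIV. borel)"
  unfolding noise_def by (rule sets_PiM_cong) auto

lemma measurable_noise_component [measurable]: "(\<lambda>\<omega>. \<omega> i) \<in> borel_measurable noise"
  unfolding measurable_cong_sets[OF sets_noise refl] by measurable

lemma distr_noise_component: "distr noise unif (\<lambda>\<omega>. \<omega> i) = unif"
  unfolding noise_def by (rule distr_PiM_component) (auto intro: prob_space_unif)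

lemma measure_noise_less:
  assumes "0 \<le> a" "a \<le> 1"
  shows "measure noise {\<omega>. \<omega> i < a} = a"
proof -
  have "measure (distr noise unif (\<lambda>\<omega>. \<omega> i)) {..<a} = measure noise {\<omega>. \<omega> i < a}"
    by (subst measure_distr) (auto simp: vimage_def)
  then show ?thesis
    using assms by (simp add: distr_noise_component measure_unif_lessThan)
qed

section \<open>Resampling a set of coordinates by an independent copy\<close>

lemma measurable_override_on [measurable]:
  "(\<lambda>(\<omega>, \<omega>'). override_on \<omega> \<omega>' J) \<in> noise \<Otimes>\<^sub>M noise \<rightarrow>\<^sub>M noise"
proof -
  have "(\<lambda>x. override_on (fst x) (snd x) J) \<in> noise \<Otimes>\<^sub>M noise \<rightarrow>\<^sub>M (\<Pi>\<^sub>M i\<in>UNIV. borel)"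
    by (rule measurable_PiM_single') (auto simp: override_on_def)
  then show ?thesis
    by (simp add: measurable_cong_sets[OF refl sets_noise] case_prod_unfold)
qed

lemma emeasure_noise_cylinder:
  assumes "finite I" "\<And>i. i \<in> I \<Longrightarrow> B i \<in> sets borel"
  shows "emeasure noise {\<omega>. \<forall>i\<in>I. \<omega> i \<in> B i} = (\<Prod>i\<in>I. emeasure unif (B i))"
proof -
  have "{\<omega>. \<forall>i\<in>I. \<omega> i \<in> B i} = prod_emb UNIV (\<lambda>_. unif) I (Pi\<^sub>E I B)"
    by (auto simp: prod_emb_def space_PiM)
  then show ?thesis
    using noise_product.emeasure_PiM_emb[of I B] assms by (simp add: noise_def)
qed

text \<open>Events restricting finitely many coordinates form an intersection-stable generator, so a
  finite measure is determined by its values on them.\<close>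

lemma noise_eqI:
  assumes "sets N = sets noise"
    and "\<And>I B. finite I \<Longrightarrow> (\<And>i. i \<in> I \<Longrightarrow> B i \<in> sets borel) \<Longrightarrow>
           emeasure N {\<omega>. \<forall>i\<in>I. \<omega> i \<in> B i} = emeasure N' {\<omega>. \<forall>i\<in>I. \<omega> i \<in> B i}"
    and "finite_measure N" "sets N' = sets noise"
  shows "N = N'"
proof (rule measure_eqI_PiM_infinite[of N UNIV "\<lambda>_. unif"])
  fix B :: "_ \<Rightarrow> real set" and I :: "'a set"
  assume "finite I" "\<And>i. i \<in> I \<Longrightarrow> B i \<in> sets unif"
  moreover have "prod_emb UNIV (\<lambda>_. unif) I (Pi\<^sub>E I B) = {\<omega>. \<forall>i\<in>I. \<omega> i \<in> B i}"
    by (auto simp: prod_emb_def space_PiM)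
  ultimately show "emeasure N (prod_emb UNIV (\<lambda>_. unif) I (Pi\<^sub>E I B)) =
      emeasure N' (prod_emb UNIV (\<lambda>_. unif) I (Pi\<^sub>E I B))"
    using assms(2)[of I B] by simp
qed (use assms in \<open>auto simp: noise_def\<close>)

lemma sets_noise_cylinder:
  assumes "finite I" "\<And>i. i \<in> I \<Longrightarrow> B i \<in> sets borel"
  shows "{\<omega>. \<forall>i\<in>I. \<omega> i \<in> B i} \<in> sets noise"
proof -
  have "{\<omega>\<in>space noise. \<forall>i\<in>I. \<omega> i \<in> B i} \<in> sets noise"
    using assms by (intro sets.sets_Collect_finite_All predE measurable_compose[OF measurable_noise_component]) auto
  then show ?thesis by simp
qed

text \<open>A cylinder over \<open>I\<close> pulls back to a rectangle: the coordinates in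
  \<open>I - J\<close> are read off the first copy, those in \<open>I \<inter> J\<close> off the
  second, and the product over \<open>I\<close> splits accordingly.\<close>

lemma distr_override_on_noise:
  "distr (noise \<Otimes>\<^sub>M noise) noise (\<lambda>(\<omega>, \<omega>'). override_on \<omega> \<omega>' J) = noise"
proof (rule noise_eqI)
  fix I :: "'a set" and B :: "'a \<Rightarrow> real set"
  assume I: "finite I" and B: "\<And>i. i \<in> I \<Longrightarrow> B i \<in> sets borel"
  have "emeasure (distr (noise \<Otimes>\<^sub>M noise) noise (\<lambda>(\<omega>, \<omega>'). override_on \<omega> \<omega>' J)) {\<omega>. \<forall>i\<in>I. \<omega> i \<in> B i}
      = emeasure (noise \<Otimes>\<^sub>M noise) ({\<omega>. \<forall>i\<in>I - J. \<omega> i \<in> B i} \<times> {\<omega>. \<forall>i\<in>I \<inter> J. \<omega> i \<in> B i})"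
    using I B by (subst emeasure_distr[OF measurable_override_on])
      (auto intro!: sets_noise_cylinder arg_cong2[where f = emeasure] simp: override_on_def space_pair_measure split: if_splits)
  also have "\<dots> = emeasure noise {\<omega>. \<forall>i\<in>I - J. \<omega> i \<in> B i} * emeasure noise {\<omega>. \<forall>i\<in>I \<inter> J. \<omega> i \<in> B i}"
    using I B by (intro noise.emeasure_pair_measure_Times sets_noise_cylinder) auto
  also have "\<dots> = (\<Prod>i\<in>I - J. emeasure unif (B i)) * (\<Prod>i\<in>I \<inter> J. emeasure unif (B i))"
    using I B by (intro arg_cong2[where f = "(*)"] emeasure_noise_cylinder) auto
  also have "\<dots> = (\<Prod>i\<in>I. emeasure unif (B i))"
    using I by (subst prod.Int_Diff[of I _ J]) (auto simp: mult.commute)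
  also have "\<dots> = emeasure noise {\<omega>. \<forall>i\<in>I. \<omega> i \<in> B i}"
    using I B by (intro emeasure_noise_cylinder[symmetric])
  finally show "emeasure (distr (noise \<Otimes>\<^sub>M noise) noise (\<lambda>(\<omega>, \<omega>'). override_on \<omega> \<omega>' J)) {\<omega>. \<forall>i\<in>I. \<omega> i \<in> B i}
      = emeasure noise {\<omega>. \<forall>i\<in>I. \<omega> i \<in> B i}" .
next
  interpret pair_prob_space noise noise ..
  show "finite_measure (distr (noise \<Otimes>\<^sub>M noise) noise (\<lambda>(\<omega>, \<omega>'). override_on \<omega> \<omega>' J))"
    by (intro finite_measure_distr) auto
qed auto

lemma emeasure_noise_resample:
  assumes [measurable]: "A \<in> sets noise"
  shows "emeasure noise A = (\<integral>\<^sup>+\<omega>. emeasure noise {\<omega>'. override_on \<omega> \<omega>' J \<in> A} \<partial>noise)"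
proof -
  have "emeasure noise A = emeasure (distr (noise \<Otimes>\<^sub>M noise) noise (\<lambda>(\<omega>, \<omega>'). override_on \<omega> \<omega>' J)) A"
    by (simp add: distr_override_on_noise)
  also have "\<dots> = emeasure (noise \<Otimes>\<^sub>M noise) ((\<lambda>(\<omega>, \<omega>'). override_on \<omega> \<omega>' J) -` A \<inter> space (noise \<Otimes>\<^sub>M noise))"
    by (rule emeasure_distr) auto
  also have "\<dots> = (\<integral>\<^sup>+\<omega>. emeasure noise (Pair \<omega> -` ((\<lambda>(\<omega>, \<omega>'). override_on \<omega> \<omega>' J) -` A \<inter> space (noise \<Otimes>\<^sub>M noise))) \<partial>noise)"
    by (rule noise.emeasure_pair_measure_alt) measurable
  finally show ?thesis
    by (simp add: vimage_def space_pair_measure)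
qed

lemma measurable_override_on2 [measurable]:
  "(\<lambda>\<omega>'. override_on \<omega> \<omega>' J) \<in> noise \<rightarrow>\<^sub>M noise"
  using measurable_compose_Pair1[OF _ measurable_override_on, of \<omega>] by simp

lemma measure_noise_conditional_le:
  assumes [measurable]: "E \<in> sets noise" "A \<in> sets noise"
    and E: "\<And>\<omega> \<omega>'. override_on \<omega> \<omega>' J \<in> E \<longleftrightarrow> \<omega> \<in> E"
    and A: "\<And>\<omega>. \<omega> \<in> E \<Longrightarrow> measure noise {\<omega>'. override_on \<omega> \<omega>' J \<in> A} \<le> c"
    and "0 \<le> c"
  shows "measure noise (E \<inter> A) \<le> c * measure noise E"
proof -
  have "emeasure noise (E \<inter> A) = (\<integral>\<^sup>+\<omega>. emeasure noise {\<omega>'. override_on \<omega> \<omega>' J \<in> E \<inter> A} \<partial>noise)"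
    by (rule emeasure_noise_resample) auto
  also have "\<dots> \<le> (\<integral>\<^sup>+\<omega>. ennreal c * indicator E \<omega> \<partial>noise)"
    using A by (intro nn_integral_mono)
      (auto simp: E indicator_def noise.emeasure_eq_measure ennreal_leI)
  also have "\<dots> = ennreal (c * measure noise E)"
    using \<open>0 \<le> c\<close> by (simp add: nn_integral_cmult noise.emeasure_eq_measure ennreal_mult)
  finally show ?thesis
    using \<open>0 \<le> c\<close> by (simp add: noise.emeasure_eq_measure)
qed

text \<open>The last two hypotheses say that \<open>E\<close> ignores the coordinates in
  \<open>J\<close> and that \<open>A\<close> reads no others. Independence is obtained below by
  choosing a suitable \<open>J\<close>.\<close>

lemma measure_noise_indep:
  assumes [measurable]: "E \<in> sets noise" "A \<in> sets noise"
    and E: "\<And>\<omega> \<omega>'. override_on \<omega> \<omega>' J \<in> E \<longleftrightarrow> \<omega> \<in> E"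
    and A: "\<And>\<omega> \<omega>'. override_on \<omega> \<omega>' J \<in> A \<longleftrightarrow> \<omega>' \<in> A"
  shows "measure noise (E \<inter> A) = measure noise E * measure noise A"
proof -
  have "emeasure noise (E \<inter> A) = (\<integral>\<^sup>+\<omega>. emeasure noise {\<omega>'. override_on \<omega> \<omega>' J \<in> E \<inter> A} \<partial>noise)"
    by (rule emeasure_noise_resample) auto
  also have "\<dots> = (\<integral>\<^sup>+\<omega>. emeasure noise A * indicator E \<omega> \<partial>noise)"
    by (intro nn_integral_cong) (auto simp: E A indicator_def)
  also have "\<dots> = ennreal (measure noise A * measure noise E)"
    by (simp add: nn_integral_cmult noise.emeasure_eq_measure ennreal_mult)
  finally show ?thesis
    by (simp add: noise.emeasure_eq_measure mult.commute)
qed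

section \<open>Poisson-binomial counts\<close>

primrec pbin :: "real list \<Rightarrow> int \<Rightarrow> real" where
  "pbin [] z = (if z = 0 then 1 else 0)"
| "pbin (p # ps) z = (1 - p) * pbin ps z + p * pbin ps (z - 1)"

primrec pbin_cdf :: "real list \<Rightarrow> int \<Rightarrow> real" where
  "pbin_cdf [] z = (if z \<ge> 0 then 1 else 0)"
| "pbin_cdf (p # ps) z = (1 - p) * pbin_cdf ps z + p * pbin_cdf ps (z - 1)"

text \<open>Minus the derivative of the distribution function when all success probabilities
  increase at unit rate.\<close>

primrec pbin_slope :: "real list \<Rightarrow> int \<Rightarrow> real" where
  "pbin_slope [] z = 0"
| "pbin_slope (p # ps) z = pbin ps z + (1 - p) * pbin_slope ps z + p * pbin_slope ps (z - 1)"

lemma pbin_nonneg: "\<forall>p\<in>set ps. 0 \<le> p \<and> p \<le> 1 \<Longrightarrow> 0 \<le> pbin ps z"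
  by (induction ps arbitrary: z) auto

lemma pbin_cdf_bounds:
  "\<forall>p\<in>set ps. 0 \<le> p \<and> p \<le> 1 \<Longrightarrow> 0 \<le> pbin_cdf ps z \<and> pbin_cdf ps z \<le> 1"
proof (induction ps arbitrary: z)
  case (Cons p ps)
  then have "0 \<le> p" "p \<le> 1" "\<And>z. 0 \<le> pbin_cdf ps z" "\<And>z. pbin_cdf ps z \<le> 1" by auto
  moreover from this have "(1 - p) * pbin_cdf ps z + p * pbin_cdf ps (z - 1) \<le> 1"
    by (intro convex_bound_le) auto
  ultimately show ?case by simp
qed auto

lemma pbin_cdf_diff: "pbin_cdf ps z - pbin_cdf ps (z - 1) = pbin ps z"
proof (induction ps arbitrary: z)
  case (Cons p ps)
  from Cons.IH[of z] Cons.IH[of "z - 1"] show ?case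
    by (simp add: algebra_simps flip: Cons.IH)
qed auto

text \<open>By the product rule, moving the head's probability contributes
  \<open>pbin_cdf ps (z - 1) - pbin_cdf ps z\<close>, which is minus a point mass; the rest comes
  from the tail by induction.\<close>

lemma pbin_cdf_deriv:
  "((\<lambda>t. pbin_cdf (map (\<lambda>p. p + t) ps) z) has_real_derivative
      - pbin_slope (map (\<lambda>p. p + t) ps) z) (at t)"
proof (induction ps arbitrary: z)
  case (Cons p ps)
  show ?case
    unfolding list.map pbin_cdf.simps pbin_slope.simps pbin_cdf_diff[symmetric]
    by (rule derivative_eq_intros Cons.IH refl)+ (simp add: algebra_simps)
qed auto

text \<open>The slope at \<open>z\<close> is the sum, over the variables, of the probability that
  all the other variables add up to \<open>z\<close>. If the whole count is \<open>z\<close>, then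
  the others add up to \<open>z\<close> or \<open>z - 1\<close> for each variable; summing over the
  variables gives the bound.\<close>

lemma length_mult_pbin_le_slope:
  "\<forall>p\<in>set ps. 0 \<le> p \<and> p \<le> 1 \<Longrightarrow>
     real (length ps) * pbin ps z \<le> pbin_slope ps z + pbin_slope ps (z - 1)"
proof (induction ps arbitrary: z)
  case (Cons p ps)
  then have p: "0 \<le> p" "p \<le> 1" and
    IH: "\<And>z. real (length ps) * pbin ps z \<le> pbin_slope ps z + pbin_slope ps (z - 1)"
    and pos: "\<And>z. 0 \<le> pbin ps z"
    by (auto intro: pbin_nonneg)
  \<comment> \<open>One copy of the mass is kept for the head; the other \<open>length ps\<close>
    copies are expanded by the recursion to meet the induction hypothesis.\<close>
  have "real (length (p # ps)) * pbin (p # ps) z = pbin (p # ps) z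
      + (1 - p) * (real (length ps) * pbin ps z) + p * (real (length ps) * pbin ps (z - 1))"
    by (simp add: algebra_simps)
  also have "\<dots> \<le> (pbin ps z + pbin ps (z - 1))
      + (1 - p) * (pbin_slope ps z + pbin_slope ps (z - 1))
      + p * (pbin_slope ps (z - 1) + pbin_slope ps (z - 1 - 1))"
  proof (intro add_mono mult_left_mono IH)
    show "pbin (p # ps) z \<le> pbin ps z + pbin ps (z - 1)"
      using p pos[of z] pos[of "z - 1"] by (auto intro!: add_mono mult_left_le_one_le)
  qed (use p in auto)
  also have "\<dots> = pbin_slope (p # ps) z + pbin_slope (p # ps) (z - 1)"
    by (simp add: algebra_simps)
  finally show ?case .
qed auto

lemma continuous_pbin:
  "continuous_on UNIV (\<lambda>t. pbin (map (\<lambda>p. p + t) ps) z)"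
  by (induction ps arbitrary: z) (auto intro!: continuous_intros)

lemma continuous_pbin_slope:
  "continuous_on UNIV (\<lambda>t. pbin_slope (map (\<lambda>p. p + t) ps) z)"
  by (induction ps arbitrary: z) (auto intro!: continuous_intros continuous_pbin)

text \<open>While \<open>v\<close> runs through the unit interval all probabilities rise at speed
  \<open>a\<close>. The point mass times the length is then at most \<open>1 / a\<close> times the
  rate at which two values of the distribution function fall, and each of these falls by at most 1
  in total.\<close>

lemma nn_integral_pbin_le:
  assumes ps: "\<forall>p\<in>set ps. 0 \<le> p \<and> p + a \<le> 1" and a: "0 < a" and "ps \<noteq> []"
  shows "(\<integral>\<^sup>+v. ennreal (pbin (map (\<lambda>p. p + a * v) ps) z) * indicator {0..1} v \<partial>lborel)
           \<le> 2 / (a * real (length ps))"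
proof -
  define n where "n = real (length ps)"
  have n: "0 < n" using \<open>ps \<noteq> []\<close> by (simp add: n_def)
  \<comment> \<open>\<open>f\<close> is the majorant given by the slope inequality and
    \<open>F\<close> an antiderivative of it; the chain rule accounts for the \<open>a\<close> in
    the denominator of \<open>F\<close>.\<close>
  define f where "f v = (pbin_slope (map (\<lambda>p. p + a * v) ps) z + pbin_slope (map (\<lambda>p. p + a * v) ps) (z - 1)) / n" for v
  define F where "F v = - (pbin_cdf (map (\<lambda>p. p + a * v) ps) z + pbin_cdf (map (\<lambda>p. p + a * v) ps) (z - 1)) / (a * n)" for v
  have range: "\<forall>p\<in>set (map (\<lambda>p. p + a * v) ps). 0 \<le> p \<and> p \<le> 1" if "0 \<le> v" "v \<le> 1" for v
  proof -
    have "0 \<le> a * v" "a * v \<le> a" using that a by (auto intro: mult_left_le)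
    then show ?thesis using ps by fastforce
  qed
  have le: "pbin (map (\<lambda>p. p + a * v) ps) z \<le> f v" if "0 \<le> v" "v \<le> 1" for v
    using length_mult_pbin_le_slope[OF range[OF that], of z] n
    by (simp add: f_def n_def field_simps)
  have f_nonneg: "0 \<le> f v" if "0 \<le> v" "v \<le> 1" for v
    using le[OF that] pbin_nonneg[OF range[OF that], of z] by linarith
  have "continuous_on UNIV f"
    unfolding f_def using n
    by (intro continuous_intros continuous_on_compose2[OF continuous_pbin_slope]) auto
  then have [measurable]: "f \<in> borel_measurable borel"
    by (rule borel_measurable_continuous_onI)
  have deriv: "(F has_real_derivative f v) (at v)" for v
  proof -
    have *: "((\<lambda>v. pbin_cdf (map (\<lambda>p. p + a * v) ps) y) has_real_derivative
        - pbin_slope (map (\<lambda>p. p + a * v) ps) y * a) (at v)" for y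
      using DERIV_chain2[OF pbin_cdf_deriv DERIV_cmult_Id] .
    show ?thesis
      unfolding F_def f_def using a n
      by (intro DERIV_cong[OF DERIV_cdivide[OF DERIV_minus[OF DERIV_add[OF * *]]]]) (simp add: field_simps)
  qed
  have "(\<integral>\<^sup>+v. ennreal (pbin (map (\<lambda>p. p + a * v) ps) z) * indicator {0..1} v \<partial>lborel)
      \<le> (\<integral>\<^sup>+v. ennreal (f v) * indicator {0..1} v \<partial>lborel)"
    by (intro nn_integral_mono) (auto simp: indicator_def intro!: ennreal_leI le)
  also have "\<dots> = ennreal (F 1 - F 0)"
    by (rule nn_integral_FTC_Icc) (auto intro: deriv f_nonneg DERIV_subset)
  also have "F 1 - F 0 \<le> 2 / (a * n)"
  proof -
    have "F 1 \<le> 0" "- 2 / (a * n) \<le> F 0"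
      unfolding F_def using a n pbin_cdf_bounds[OF range, of 0] pbin_cdf_bounds[OF range, of 1]
      by (auto intro!: divide_right_mono divide_nonpos_pos simp del: minus_add_distrib)
         (smt (verit, best))+
    then show ?thesis by simp
  qed
  finally show ?thesis
    by (simp add: n_def ennreal_leI)
qed

section \<open>Counting noise coordinates below given thresholds\<close>

lemma measurable_int_sum [measurable (raw)]:
  fixes f :: "'i \<Rightarrow> 'a \<Rightarrow> int"
  assumes [measurable]: "\<And>i. i \<in> I \<Longrightarrow> f i \<in> M \<rightarrow>\<^sub>M count_space UNIV"
  shows "(\<lambda>x. \<Sum>i\<in>I. f i x) \<in> M \<rightarrow>\<^sub>M count_space UNIV"
  using assms
proof (induction I rule: infinite_finite_induct)
  case (insert i I)
  have [measurable]: "f i \<in> M \<rightarrow>\<^sub>M count_space UNIV" "(\<lambda>x. \<Sum>i\<in>I. f i x) \<in> M \<rightarrow>\<^sub>M count_space UNIV"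
    using insert by auto
  have "(\<lambda>x. f i x + (\<Sum>i\<in>I. f i x)) \<in> M \<rightarrow>\<^sub>M count_space UNIV"
    by measurable
  then show ?case using insert by simp
qed auto

lemma measure_noise_count_eq:
  assumes "distinct is" "\<forall>i\<in>set is. 0 \<le> p i \<and> p i \<le> 1"
  shows "measure noise {\<omega>. (\<Sum>i\<in>set is. if \<omega> i < p i then 1 else 0 :: int) = z} = pbin (map p is) z"
  using assms
proof (induction "is" arbitrary: z)
  case (Cons i "is")
  let ?N = "\<lambda>\<omega>. \<Sum>i\<in>set is. if \<omega> i < p i then 1 else 0 :: int"
  have [measurable]: "{\<omega>. ?N \<omega> = z} \<in> sets noise" for z
  proof -
    have "{\<omega>\<in>space noise. ?N \<omega> = z} \<in> sets noise" by measurable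
    then show ?thesis by simp
  qed
  have [measurable]: "{\<omega>. \<omega> i < p i} \<in> sets noise" "{\<omega>. \<not> \<omega> i < p i} \<in> sets noise"
  proof -
    have "{\<omega>\<in>space noise. \<omega> i < p i} \<in> sets noise" "{\<omega>\<in>space noise. \<not> \<omega> i < p i} \<in> sets noise"
      by measurable
    then show "{\<omega>. \<omega> i < p i} \<in> sets noise" "{\<omega>. \<not> \<omega> i < p i} \<in> sets noise" by auto
  qed
  have N: "?N (override_on \<omega> \<omega>' {i}) = ?N \<omega>" for \<omega> \<omega>'
    using Cons.prems by (intro sum.cong) (auto simp: override_on_def)
  have "{\<omega>. \<not> \<omega> i < p i} = space noise - {\<omega>. \<omega> i < p i}" by auto
  then have pc: "measure noise {\<omega>. \<not> \<omega> i < p i} = 1 - p i"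
    using noise.prob_compl[of "{\<omega>. \<omega> i < p i}"] measure_noise_less[of "p i" i] Cons.prems by simp
  have "{\<omega>. (\<Sum>i\<in>set (i # is). if \<omega> i < p i then 1 else 0 :: int) = z}
      = ({\<omega>. ?N \<omega> = z} \<inter> {\<omega>. \<not> \<omega> i < p i}) \<union> ({\<omega>. ?N \<omega> = z - 1} \<inter> {\<omega>. \<omega> i < p i})"
    using Cons.prems by (auto split: if_splits)
  also have "measure noise \<dots> = measure noise ({\<omega>. ?N \<omega> = z} \<inter> {\<omega>. \<not> \<omega> i < p i})
      + measure noise ({\<omega>. ?N \<omega> = z - 1} \<inter> {\<omega>. \<omega> i < p i})"
    by (rule noise.finite_measure_Union) auto
  also have "\<dots> = measure noise {\<omega>. ?N \<omega> = z} * measure noise {\<omega>. \<not> \<omega> i < p i}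
      + measure noise {\<omega>. ?N \<omega> = z - 1} * measure noise {\<omega>. \<omega> i < p i}"
    by (intro arg_cong2[where f = "(+)"] measure_noise_indep[where J = "{i}"])
       (auto simp only: mem_Collect_eq N, auto)
  also have "\<dots> = pbin (map p (i # is)) z"
    using Cons by (simp add: measure_noise_less pc)
  finally show ?case .
qed (auto simp: noise.prob_space[simplified])

text \<open>The noise lives on all real sequences and is in the unit interval only almost surely.\<close>

definition clip :: "real \<Rightarrow> real" where
  "clip v = max 0 (min 1 v)"

lemma clip_bounds [simp]: "0 \<le> clip v" "clip v \<le> 1"
  by (auto simp: clip_def)

lemma measurable_clip [measurable]: "clip \<in> borel_measurable borel"
  unfolding clip_def by measurable

text \<open>Given coordinate \<open>c\<close>, the count is Poisson-binomial with all probabilities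
  moved by the same amount. Since that coordinate is uniform, averaging over it produces the
  integral bounded in \<open>nn_integral_pbin_le\<close>.\<close>

lemma measure_noise_count_common_shift_le:
  assumes I: "finite I" "I \<noteq> {}" "c \<notin> I" and p: "\<And>i. i \<in> I \<Longrightarrow> 0 \<le> p i \<and> p i + a \<le> 1" and a: "0 < a"
  shows "measure noise {\<omega>. (\<Sum>i\<in>I. if \<omega> i < p i + a * clip (\<omega> c) then 1 else 0 :: int) = z}
           \<le> 2 / (a * real (card I))" (is "measure noise ?A \<le> _")
proof -
  obtain "is" where "is": "set is = I" "distinct is"
    using finite_distinct_list[OF I(1)] by blast
  have [measurable]: "?A \<in> sets noise"
  proof -
    have "{\<omega>\<in>space noise. (\<Sum>i\<in>I. if \<omega> i < p i + a * clip (\<omega> c) then 1 else 0 :: int) = z} \<in> sets noise"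
      by measurable
    then show ?thesis by simp
  qed
  have clip: "0 \<le> a * clip v" "a * clip v \<le> a" for v
    using a by (auto intro: mult_left_le)
  define g where "g v = pbin (map (\<lambda>p. p + a * v) (map p is)) z" for v
  have [measurable]: "g \<in> borel_measurable borel"
    unfolding g_def
    by (intro borel_measurable_continuous_onI continuous_on_compose2[OF continuous_pbin] continuous_intros) auto
  have gc: "(\<lambda>v. ennreal (g (clip v))) \<in> borel_measurable unif"
    unfolding measurable_cong_sets[OF sets_unif refl] by measurable
  \<comment> \<open>Resampling the complement of \<open>c\<close> amounts to conditioning on
    coordinate \<open>c\<close>.\<close>
  have "emeasure noise ?A = (\<integral>\<^sup>+\<omega>. emeasure noise {\<omega>'. override_on \<omega> \<omega>' (- {c}) \<in> ?A} \<partial>noise)"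
    by (rule emeasure_noise_resample) measurable
  also have "\<dots> = (\<integral>\<^sup>+\<omega>. ennreal (g (clip (\<omega> c))) \<partial>noise)"
  proof (rule nn_integral_cong)
    fix \<omega> :: "'a \<Rightarrow> real"
    have "{\<omega>'. override_on \<omega> \<omega>' (- {c}) \<in> ?A}
        = {\<omega>'. (\<Sum>i\<in>set is. if \<omega>' i < p i + a * clip (\<omega> c) then 1 else 0 :: int) = z}"
      using I(3) "is"(1) by (auto simp: override_on_def intro!: sum.cong elim!: back_subst[of "\<lambda>x. x = z"])
    also have "measure noise \<dots> = pbin (map (\<lambda>i. p i + a * clip (\<omega> c)) is) z"
      using p clip[of "\<omega> c"] "is" by (intro measure_noise_count_eq) fastforce+
    finally have "measure noise {\<omega>'. override_on \<omega> \<omega>' (- {c}) \<in> ?A} = g (clip (\<omega> c))"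
      by (simp add: g_def o_def)
    then show "emeasure noise {\<omega>'. override_on \<omega> \<omega>' (- {c}) \<in> ?A} = ennreal (g (clip (\<omega> c)))"
      by (simp add: noise.emeasure_eq_measure)
  qed
  also have "\<dots> = (\<integral>\<^sup>+v. ennreal (g (clip v)) \<partial>distr noise unif (\<lambda>\<omega>. \<omega> c))"
    using gc by (subst nn_integral_distr) (auto simp: measurable_cong_sets[OF refl sets_unif])
  also have "\<dots> = (\<integral>\<^sup>+v. ennreal (g (clip v)) * indicator {0..1} v \<partial>lborel)"
    by (simp add: distr_noise_component nn_integral_unif)
  also have "\<dots> = (\<integral>\<^sup>+v. ennreal (g v) * indicator {0..1} v \<partial>lborel)"
    by (intro nn_integral_cong) (auto simp: clip_def indicator_def)
  also have "\<dots> \<le> ennreal (2 / (a * real (length (map p is))))"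
    unfolding g_def using p a I "is" by (intro nn_integral_pbin_le) auto
  finally show ?thesis
    using a distinct_card[OF "is"(2)] "is"(1) by (simp add: noise.emeasure_eq_measure)
qed

lemma sets_noise_Collect:
  "Measurable.pred noise P \<Longrightarrow> {\<omega>. P \<omega>} \<in> sets noise"
  by (simp add: pred_def)

section \<open>The multiscale process\<close>

locale multiscale =
  fixes L :: "nat \<Rightarrow> nat"
  assumes L_pos: "0 < L j"
begin

text \<open>At site \<open>i\<close>, coordinate \<open>0\<close> of the noise decides the increment, while coordinates
  \<open>2 * j + 1\<close> and \<open>2 * j + 2\<close> give the flag and the value at scale \<open>j\<close>.\<close>

definition flag :: "nat \<Rightarrow> nat \<Rightarrow> (nat \<times> nat \<Rightarrow> real) \<Rightarrow> bool" where
  "flag j i \<omega> \<longleftrightarrow> \<omega> (i, 2 * j + 1) < 1 / (2 * real (L j))"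

text \<open>The search stops after \<open>l\<close> sites, which keeps the dependence on the noise
  local at each scale; 0 is the default when no flag is met.\<close>

primrec first_value :: "nat \<Rightarrow> nat \<Rightarrow> nat \<Rightarrow> (nat \<times> nat \<Rightarrow> real) \<Rightarrow> real" where
  "first_value j 0 i \<omega> = 0"
| "first_value j (Suc l) i \<omega> =
     (if flag j i \<omega> then clip (\<omega> (i, 2 * j + 2)) else first_value j l (Suc i) \<omega>)"

text \<open>The weights sum to 1, so this is a probability whatever values are seen.\<close>

definition bias :: "nat \<Rightarrow> (nat \<times> nat \<Rightarrow> real) \<Rightarrow> real" where
  "bias i \<omega> = (\<Sum>j. (1/2) ^ Suc j * first_value j (L j) i \<omega>)"

definition incr :: "nat \<Rightarrow> (nat \<times> nat \<Rightarrow> real) \<Rightarrow> int" where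
  "incr i \<omega> = (if \<omega> (i, 0) < bias i \<omega> then 1 else - 1)"

text \<open>The sites \<open>i \<le> m\<close> with \<open>m < i + L j\<close> are then exactly
  those whose scale-\<open>j\<close> search ends at \<open>m\<close>. Writing the window this way
  avoids truncated subtraction.\<close>

definition good :: "nat \<Rightarrow> nat \<Rightarrow> (nat \<times> nat \<Rightarrow> real) \<Rightarrow> bool" where
  "good j m \<omega> \<longleftrightarrow> flag j m \<omega> \<and> (\<forall>i<m. m < i + L j \<longrightarrow> \<not> flag j i \<omega>)"

definition past :: "nat \<Rightarrow> (nat \<Rightarrow> int) \<Rightarrow> (nat \<times> nat \<Rightarrow> real) set" where
  "past n h = {\<omega>. \<forall>i<n. incr i \<omega> = h i}"

lemma measurable_flag [measurable]: "Measurable.pred noise (flag j i)"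
  unfolding flag_def by measurable

lemma measurable_good [measurable]: "Measurable.pred noise (good j m)"
  unfolding good_def by measurable

lemma measurable_first_value [measurable]: "first_value j l i \<in> borel_measurable noise"
proof (induction l arbitrary: i)
  case (Suc l)
  note [measurable] = Suc.IH
  have "first_value j (Suc l) i =
      (\<lambda>\<omega>. if flag j i \<omega> then clip (\<omega> (i, 2 * j + 2)) else first_value j l (Suc i) \<omega>)"
    by auto
  then show ?case by (simp only:) measurable
next
  case 0
  have "first_value j 0 i = (\<lambda>\<omega>. 0)" by auto
  then show ?case by (simp only:) measurable
qed

lemma measurable_bias [measurable]: "bias i \<in> borel_measurable noise"
  unfolding bias_def by measurable

lemma measurable_incr [measurable]: "incr i \<in> noise \<rightarrow>\<^sub>M count_space UNIV"
  unfolding incr_def by measurable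

lemma sets_past [measurable]: "past n h \<in> sets noise"
  unfolding past_def by (rule sets_noise_Collect) measurable

lemma first_value_bounds: "0 \<le> first_value j l i \<omega> \<and> first_value j l i \<omega> \<le> 1"
  by (induction l arbitrary: i) auto

lemma first_value_cong:
  assumes "\<And>i'. i \<le> i' \<Longrightarrow> i' < i + l \<Longrightarrow>
             \<omega> (i', 2 * j + 1) = \<omega>' (i', 2 * j + 1) \<and> \<omega> (i', 2 * j + 2) = \<omega>' (i', 2 * j + 2)"
  shows "first_value j l i \<omega> = first_value j l i \<omega>'"
  using assms
proof (induction l arbitrary: i)
  case (Suc l)
  from Suc.prems[of i] Suc.IH[of "Suc i"] Suc.prems show ?case
    by (auto simp: flag_def)
qed auto

lemma first_value_eq:
  assumes "flag j m \<omega>" "\<And>i'. i \<le> i' \<Longrightarrow> i' < m \<Longrightarrow> \<not> flag j i' \<omega>" "i \<le> m" "m < i + l"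
  shows "first_value j l i \<omega> = clip (\<omega> (m, 2 * j + 2))"
  using assms
proof (induction l arbitrary: i)
  case (Suc l)
  show ?case
  proof (cases "i = m")
    case False
    then show ?thesis
      using Suc.prems Suc.IH[of "Suc i"] by auto
  qed (use Suc.prems in auto)
qed auto

text \<open>The look-ahead depends on the scale, but nothing before site \<open>i\<close> is read.
  The bounded look-ahead makes far noise fresh; the one-sidedness yields ergodicity.\<close>

lemma incr_cong:
  assumes "\<omega> (i, 0) = \<omega>' (i, 0)"
    and "\<And>j i'. i \<le> i' \<Longrightarrow> i' < i + L j \<Longrightarrow>
           \<omega> (i', 2 * j + 1) = \<omega>' (i', 2 * j + 1) \<and> \<omega> (i', 2 * j + 2) = \<omega>' (i', 2 * j + 2)"
  shows "incr i \<omega> = incr i \<omega>'"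
proof -
  have "first_value j (L j) i \<omega> = first_value j (L j) i \<omega>'" for j
    using assms(2) by (rule first_value_cong)
  then show ?thesis
    by (simp add: incr_def bias_def assms(1))
qed

lemma summable_geometric_bounded:
  fixes x :: "nat \<Rightarrow> real"
  assumes "\<And>j. 0 \<le> x j" "\<And>j. x j \<le> 1"
  shows "summable (\<lambda>j. (1/2) ^ Suc j * x j)"
  using assms by (intro summable_comparison_test'[OF sums_summable[OF power_half_series], of 0])
    (auto intro!: mult_left_le)

lemma suminf_geometric_bounded:
  fixes x :: "nat \<Rightarrow> real"
  assumes "\<And>j. 0 \<le> x j" "\<And>j. x j \<le> 1"
  shows "0 \<le> (\<Sum>j. (1/2) ^ Suc j * x j)" "(\<Sum>j. (1/2) ^ Suc j * x j) \<le> 1"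
proof -
  show "0 \<le> (\<Sum>j. (1/2) ^ Suc j * x j)"
    using assms summable_geometric_bounded[of x] by (intro suminf_nonneg) auto
  have "(\<Sum>j. (1/2) ^ Suc j * x j) \<le> (\<Sum>j. (1/2::real) ^ Suc j)"
    using assms summable_geometric_bounded[of x] sums_summable[OF power_half_series]
    by (intro suminf_le) (auto intro!: mult_left_le)
  then show "(\<Sum>j. (1/2) ^ Suc j * x j) \<le> 1"
    using sums_unique[OF power_half_series] by simp
qed

text \<open>Separates one scale from the rest: the bias is an affine function of the value seen at
  scale \<open>m\<close>.\<close>

lemma suminf_geometric_fun_upd:
  fixes x :: "nat \<Rightarrow> real"
  assumes "\<And>j. 0 \<le> x j" "\<And>j. x j \<le> 1"
  shows "(\<Sum>j. (1/2) ^ Suc j * (x(m := v)) j) = (\<Sum>j. (1/2) ^ Suc j * (x(m := 0)) j) + (1/2) ^ Suc m * v"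
proof -
  have "(\<lambda>j. (1/2) ^ Suc j * (x(m := 0)) j) sums (\<Sum>j. (1/2) ^ Suc j * (x(m := 0)) j)"
    using assms by (intro summable_sums summable_geometric_bounded) auto
  moreover have "(\<lambda>j. if j = m then (1/2) ^ Suc j * v else 0) sums ((1/2) ^ Suc m * v)"
    by (rule sums_single)
  ultimately have "(\<lambda>j. (1/2) ^ Suc j * (x(m := 0)) j + (if j = m then (1/2) ^ Suc j * v else 0))
      sums ((\<Sum>j. (1/2) ^ Suc j * (x(m := 0)) j) + (1/2) ^ Suc m * v)"
    by (rule sums_add)
  also have "(\<lambda>j. (1/2) ^ Suc j * (x(m := 0)) j + (if j = m then (1/2) ^ Suc j * v else 0))
      = (\<lambda>j. (1/2) ^ Suc j * (x(m := v)) j)"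
    by (auto simp: fun_eq_iff)
  finally show ?thesis by (simp add: sums_iff)
qed

section \<open>Noise not read by the past, and resampling within one window\<close>

lemma override_flag:
  "(i, 2 * j + 1) \<notin> J \<Longrightarrow> flag j i (override_on \<omega> \<omega>' J) \<longleftrightarrow> flag j i \<omega>"
  "(i, 2 * j + 1) \<in> J \<Longrightarrow> flag j i (override_on \<omega> \<omega>' J) \<longleftrightarrow> flag j i \<omega>'"
  by (auto simp: flag_def override_on_def)

text \<open>Increments before \<open>n\<close> look ahead fewer than \<open>L j\<close> sites at
  scale \<open>j\<close>. Scale-\<open>j\<close> noise is therefore fresh from site
  \<open>n + L j\<close> on, a position that differs from scale to scale, and the deciding
  coordinates are fresh from \<open>n\<close> on.\<close>

lemma override_past:
  assumes "\<And>i c. (i, c) \<in> J \<Longrightarrow> (\<exists>j. (c = 2 * j + 1 \<or> c = 2 * j + 2) \<and> n + L j \<le> i) \<or> c = 0 \<and> n \<le> i"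
  shows "override_on \<omega> \<omega>' J \<in> past n h \<longleftrightarrow> \<omega> \<in> past n h"
proof -
  have "incr i (override_on \<omega> \<omega>' J) = incr i \<omega>" if "i < n" for i
  proof (rule incr_cong)
    show "override_on \<omega> \<omega>' J (i, 0) = \<omega> (i, 0)"
      using assms[of i 0] that by (auto simp: override_on_def)
    fix j i' assume "i' < i + L j"
    then have "(i', 2 * j + 1) \<notin> J" "(i', 2 * j + 2) \<notin> J"
      using assms[of i' "2 * j + 1"] assms[of i' "2 * j + 2"] that
      by (auto simp: Suc_double_not_eq_double double_not_eq_Suc_double)
    then show "override_on \<omega> \<omega>' J (i', 2 * j + 1) = \<omega> (i', 2 * j + 1) \<and>
        override_on \<omega> \<omega>' J (i', 2 * j + 2) = \<omega> (i', 2 * j + 2)"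
      by (auto simp: override_on_def)
  qed
  then show ?thesis by (simp add: past_def)
qed

lemma measure_flag: "measure noise {\<omega>. flag j i \<omega>} = 1 / (2 * real (L j))"
  unfolding flag_def using L_pos[of j] by (intro measure_noise_less) (auto simp: field_simps)

text \<open>All noise is frozen except the value at \<open>m\<close> and the deciding coordinates of
  the \<open>L j\<close> sites that see it. Neither the past nor \<open>good j m\<close> changes
  under this resampling, and the only random part of the sum is a count with a common uniform
  shift.\<close>

lemma measure_good_sum_le:
  assumes m: "n + 2 * L j \<le> m" "m < n + k"
  shows "measure noise (past n h \<inter> {\<omega>. good j m \<omega>} \<inter> {\<omega>. (\<Sum>i=n..<n+k. incr i \<omega>) = y})
           \<le> 4 * 2 ^ j / real (L j) * measure noise (past n h \<inter> {\<omega>. good j m \<omega>})"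
proof (rule measure_noise_conditional_le)
  define I where "I = {Suc m - L j..m}"
  define J where "J = insert (m, 2 * j + 2) ((\<lambda>i. (i, 0)) ` I)"
  have I: "finite I" "card I = L j" "I \<subseteq> {n..<n+k}" "m \<in> I"
    using m L_pos[of j] by (auto simp: I_def)
  show "past n h \<inter> {\<omega>. good j m \<omega>} \<in> sets noise"
    by (intro sets.Int sets_past sets_noise_Collect) measurable
  show "{\<omega>. (\<Sum>i=n..<n+k. incr i \<omega>) = y} \<in> sets noise"
    by (rule sets_noise_Collect) measurable
  have flag_J: "flag j i (override_on \<omega> \<omega>' J) \<longleftrightarrow> flag j i \<omega>" for i \<omega> \<omega>'
    by (rule override_flag) (auto simp: J_def)
  then have good_J: "good j m (override_on \<omega> \<omega>' J) \<longleftrightarrow> good j m \<omega>" for \<omega> \<omega>'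
    by (simp add: good_def)
  have "override_on \<omega> \<omega>' J \<in> past n h \<longleftrightarrow> \<omega> \<in> past n h" for \<omega> \<omega>'
    using m I(3) by (intro override_past) (auto simp: J_def)
  with good_J show "override_on \<omega> \<omega>' J \<in> past n h \<inter> {\<omega>. good j m \<omega>} \<longleftrightarrow>
      \<omega> \<in> past n h \<inter> {\<omega>. good j m \<omega>}" for \<omega> \<omega>' by simp
  fix \<omega> assume "\<omega> \<in> past n h \<inter> {\<omega>. good j m \<omega>}"
  then have good: "good j m \<omega>" by simp
  define x where "x i = (\<lambda>j'. first_value j' (L j') i \<omega>)" for i
  have x: "\<And>i j'. 0 \<le> x i j'" "\<And>i j'. x i j' \<le> 1"
    using first_value_bounds by (auto simp: x_def)
  \<comment> \<open>\<open>p i\<close> is the bias coming from all scales other than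
    \<open>j\<close>; it stays frozen.\<close>
  define p where "p i = (\<Sum>j'. (1/2) ^ Suc j' * ((x i)(j := 0)) j')" for i
  define a :: real where "a = (1/2) ^ Suc j"
  have p: "0 \<le> p i" "p i + a \<le> 1" for i
  proof -
    show "0 \<le> p i"
      unfolding p_def using x by (intro suminf_geometric_bounded) auto
    \<comment> \<open>Adding \<open>a\<close> amounts to seeing the largest value 1 at scale
      \<open>j\<close>, which still gives a bias of at most 1.\<close>
    have "p i + a = (\<Sum>j'. (1/2) ^ Suc j' * ((x i)(j := 1)) j')"
      unfolding p_def a_def using suminf_geometric_fun_upd[of "x i" j 1] x by simp
    also have "\<dots> \<le> 1"
      using x by (intro suminf_geometric_bounded) auto
    finally show "p i + a \<le> 1" .
  qed
  have incr_I: "incr i (override_on \<omega> \<omega>' J) =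
      2 * (if \<omega>' (i, 0) < p i + a * clip (\<omega>' (m, 2 * j + 2)) then 1 else 0) - 1" if "i \<in> I" for i \<omega>'
  proof -
    have "first_value j' (L j') i (override_on \<omega> \<omega>' J) = ((x i)(j := clip (\<omega>' (m, 2 * j + 2)))) j'" for j'
    proof (cases "j' = j")
      case True
      have "first_value j (L j) i (override_on \<omega> \<omega>' J) = clip (override_on \<omega> \<omega>' J (m, 2 * j + 2))"
        using good that m by (intro first_value_eq) (auto simp: flag_J good_def I_def)
      also have "\<dots> = clip (\<omega>' (m, 2 * j + 2))"
        by (simp add: override_on_def J_def)
      finally show ?thesis using True by simp
    next
      case False
      have "first_value j' (L j') i (override_on \<omega> \<omega>' J) = first_value j' (L j') i \<omega>"
        using False by (intro first_value_cong) (auto simp: override_on_def J_def)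
      then show ?thesis using False by (simp add: x_def)
    qed
    then have "bias i (override_on \<omega> \<omega>' J) = p i + a * clip (\<omega>' (m, 2 * j + 2))"
      unfolding p_def a_def suminf_geometric_fun_upd[OF x, symmetric] by (simp only: bias_def)
    moreover have "override_on \<omega> \<omega>' J (i, 0) = \<omega>' (i, 0)"
      using that by (simp add: override_on_def J_def)
    ultimately show ?thesis by (simp add: incr_def)
  qed
  \<comment> \<open>The resampled value sits at \<open>m\<close> and is within reach only of sites
    \<open>i \<le> m\<close> with \<open>m < i + L j\<close>, all of which lie in
    \<open>I\<close>.\<close>
  have incr_not_I: "incr i (override_on \<omega> \<omega>' J) = incr i \<omega>" if "i \<notin> I" for i \<omega>'
    using that by (intro incr_cong) 
      (auto simp: override_on_def J_def I_def Suc_double_not_eq_double double_not_eq_Suc_double)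
  define c where "c = (\<Sum>i\<in>{n..<n+k} - I. incr i \<omega>)"
  let ?I = "(\<lambda>i. (i, 0 :: nat)) ` I"
  let ?count = "\<lambda>\<omega>'. \<Sum>i\<in>?I. if \<omega>' i < p (fst i) + a * clip (\<omega>' (m, 2 * j + 2)) then 1 else 0 :: int"
  have "(\<Sum>i=n..<n+k. incr i (override_on \<omega> \<omega>' J)) = c + 2 * ?count \<omega>' - int (L j)" for \<omega>'
  proof -
    have "(\<Sum>i=n..<n+k. incr i (override_on \<omega> \<omega>' J))
        = (\<Sum>i\<in>{n..<n+k} - I. incr i (override_on \<omega> \<omega>' J)) + (\<Sum>i\<in>I. incr i (override_on \<omega> \<omega>' J))"
      using I by (intro sum.subset_diff) auto
    also have "(\<Sum>i\<in>{n..<n+k} - I. incr i (override_on \<omega> \<omega>' J)) = c"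
      unfolding c_def by (intro sum.cong) (auto simp: incr_not_I)
    also have "(\<Sum>i\<in>I. incr i (override_on \<omega> \<omega>' J)) = 2 * ?count \<omega>' - int (L j)"
      by (simp add: incr_I sum.reindex inj_on_def sum_subtractf sum_distrib_left I)
    finally show ?thesis by simp
  qed
  \<comment> \<open>The sum determines the count. For the wrong parity of \<open>y\<close> the left
    side is empty while the quotient is rounded, hence an inclusion only.\<close>
  then have sub: "{\<omega>'. override_on \<omega> \<omega>' J \<in> {\<omega>. (\<Sum>i=n..<n+k. incr i \<omega>) = y}}
      \<subseteq> {\<omega>'. ?count \<omega>' = (y + int (L j) - c) div 2}"
    by auto
  have "measure noise {\<omega>'. override_on \<omega> \<omega>' J \<in> {\<omega>. (\<Sum>i=n..<n+k. incr i \<omega>) = y}}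
      \<le> measure noise {\<omega>'. ?count \<omega>' = (y + int (L j) - c) div 2}"
    by (intro noise.finite_measure_mono sub sets_noise_Collect) measurable
  also have "\<dots> \<le> 2 / (a * real (card ?I))"
    using I p by (intro measure_noise_count_common_shift_le) (auto simp: a_def)
  also have "\<dots> = 4 * 2 ^ j / real (L j)"
    using I by (simp add: card_image inj_on_def a_def field_simps)
  finally show "measure noise {\<omega>'. override_on \<omega> \<omega>' J \<in> {\<omega>. (\<Sum>i=n..<n+k. incr i \<omega>) = y}}
      \<le> 4 * 2 ^ j / real (L j)" .
qed auto

section \<open>Bounding the predictability\<close>

lemma measure_past_flag:
  assumes "n + L j \<le> m"
  shows "measure noise (past n h \<inter> {\<omega>. flag j m \<omega>}) = measure noise (past n h) / (2 * real (L j))"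
proof -
  have "measure noise (past n h \<inter> {\<omega>. flag j m \<omega>}) = measure noise (past n h) * measure noise {\<omega>. flag j m \<omega>}"
  proof (rule measure_noise_indep[where J = "{(m, 2 * j + 1)}"])
    show "{\<omega>. flag j m \<omega>} \<in> sets noise"
      by (rule sets_noise_Collect) measurable
    show "override_on \<omega> \<omega>' {(m, 2 * j + 1)} \<in> past n h \<longleftrightarrow> \<omega> \<in> past n h" for \<omega> \<omega>'
      using assms by (intro override_past) auto
    show "override_on \<omega> \<omega>' {(m, 2 * j + 1)} \<in> {\<omega>. flag j m \<omega>} \<longleftrightarrow> \<omega>' \<in> {\<omega>. flag j m \<omega>}" for \<omega> \<omega>'
      by (simp add: override_flag)
  qed simp
  then show ?thesis by (simp add: measure_flag)
qed

section \<open>Blocks that supply a good site\<close>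

definition no_flag :: "nat \<Rightarrow> nat \<Rightarrow> nat \<Rightarrow> (nat \<times> nat \<Rightarrow> real) set" where
  "no_flag j s l = {\<omega>. \<forall>i\<in>{s..<s+l}. \<not> flag j i \<omega>}"

text \<open>Outside this event the first flag in the second half of the block has at least
  \<open>L j\<close> unflagged sites directly before it.\<close>

definition bad_block :: "nat \<Rightarrow> nat \<Rightarrow> (nat \<times> nat \<Rightarrow> real) set" where
  "bad_block j s = - (no_flag j s (L j) - no_flag j (s + L j) (L j))"

lemma sets_no_flag [measurable]: "no_flag j s l \<in> sets noise"
  unfolding no_flag_def by (rule sets_noise_Collect) measurable

lemma sets_bad_block [measurable]: "bad_block j s \<in> sets noise"
proof -
  have "bad_block j s = space noise - (no_flag j s (L j) - no_flag j (s + L j) (L j))"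
    by (auto simp: bad_block_def)
  then show ?thesis by (simp only:) (intro sets.Diff sets.top sets_no_flag)
qed

lemma override_no_flag:
  "(\<And>i. s \<le> i \<Longrightarrow> i < s + l \<Longrightarrow> (i, 2 * j + 1) \<notin> J) \<Longrightarrow>
     override_on \<omega> \<omega>' J \<in> no_flag j s l \<longleftrightarrow> \<omega> \<in> no_flag j s l"
  "(\<And>i. s \<le> i \<Longrightarrow> i < s + l \<Longrightarrow> (i, 2 * j + 1) \<in> J) \<Longrightarrow>
     override_on \<omega> \<omega>' J \<in> no_flag j s l \<longleftrightarrow> \<omega>' \<in> no_flag j s l"
  by (auto simp: no_flag_def override_flag)

lemma override_bad_block:
  "(\<And>i. s \<le> i \<Longrightarrow> i < s + 2 * L j \<Longrightarrow> (i, 2 * j + 1) \<notin> J) \<Longrightarrow>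
     override_on \<omega> \<omega>' J \<in> bad_block j s \<longleftrightarrow> \<omega> \<in> bad_block j s"
  "(\<And>i. s \<le> i \<Longrightarrow> i < s + 2 * L j \<Longrightarrow> (i, 2 * j + 1) \<in> J) \<Longrightarrow>
     override_on \<omega> \<omega>' J \<in> bad_block j s \<longleftrightarrow> \<omega>' \<in> bad_block j s"
  by (simp_all add: bad_block_def override_no_flag)

lemma measure_no_flag: "measure noise (no_flag j s l) = (1 - 1 / (2 * real (L j))) ^ l"
proof (induction l)
  case 0
  then show ?case using noise.prob_space by (simp add: no_flag_def)
next
  case (Suc l)
  have 1: "{\<omega>. flag j (s + l) \<omega>} \<in> sets noise"
    by (rule sets_noise_Collect) measurable
  have "no_flag j s (Suc l) = no_flag j s l \<inter> (space noise - {\<omega>. flag j (s + l) \<omega>})"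
    by (auto simp: no_flag_def less_Suc_eq)
  also have "measure noise \<dots> = measure noise (no_flag j s l) * measure noise (space noise - {\<omega>. flag j (s + l) \<omega>})"
    using 1 by (intro measure_noise_indep[where J = "{(s + l, 2 * j + 1)}"] sets.Diff sets.top)
      (auto simp: override_no_flag override_flag)
  also have "measure noise (space noise - {\<omega>. flag j (s + l) \<omega>}) = 1 - 1 / (2 * real (L j))"
    using 1 by (simp only: noise.prob_compl measure_flag)
  finally show ?case using Suc by simp
qed

text \<open>With \<open>x\<close> the probability that a half block is unflagged, the block avoids
  being bad with probability \<open>x * (1 - x)\<close>. Since \<open>x\<close> lies between 1/2 and
  2/3, this is at least 1/6.\<close>

lemma measure_bad_block_le: "measure noise (bad_block j s) \<le> 5 / 6"
proof -
  define x where "x = (1 - 1 / (2 * real (L j))) ^ L j"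
  have "1 + real (L j) * (- 1 / (2 * real (L j))) \<le> (1 + (- 1 / (2 * real (L j)))) ^ L j"
    using L_pos[of j] by (intro Bernoulli_inequality) (auto simp: field_simps)
  then have x1: "1 / 2 \<le> x"
    using L_pos[of j] by (simp add: x_def)
  \<comment> \<open>For the upper bound on \<open>x\<close>, the conjugate power is at least 3/2 by
    Bernoulli's inequality, while its product with \<open>x\<close> is a power of a number in the
    unit interval.\<close>
  have "1 + real (L j) * (1 / (2 * real (L j))) \<le> (1 + 1 / (2 * real (L j))) ^ L j"
    by (intro Bernoulli_inequality) (auto intro: order_trans[of _ 0])
  then have "3 / 2 \<le> (1 + 1 / (2 * real (L j))) ^ L j"
    using L_pos[of j] by simp
  then have "x * (3 / 2) \<le> x * (1 + 1 / (2 * real (L j))) ^ L j"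
    using x1 by (intro mult_left_mono) auto
  also have "\<dots> = (1 - (1 / (2 * real (L j)))\<^sup>2) ^ L j"
    by (simp add: x_def power2_eq_square algebra_simps flip: power_mult_distrib)
  finally have x3: "x * (3 / 2) \<le> (1 - (1 / (2 * real (L j)))\<^sup>2) ^ L j" .
  have "(1 / (2 * real (L j)))\<^sup>2 \<le> 1"
    using L_pos[of j] by (intro power_le_one) (auto simp: field_simps)
  then have "(1 - (1 / (2 * real (L j)))\<^sup>2) ^ L j \<le> 1"
    by (intro power_le_one) auto
  with x3 have x2: "x \<le> 2 / 3" by simp
  have x4: "1 / 6 \<le> x * (1 - x)"
    using mult_mono[of "1 / 2" x "1 / 3" "1 - x"] x1 x2 by simp
  have "no_flag j s (L j) - no_flag j (s + L j) (L j)
      = no_flag j s (L j) \<inter> (space noise - no_flag j (s + L j) (L j))" by auto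
  also have "measure noise \<dots> = measure noise (no_flag j s (L j)) * measure noise (space noise - no_flag j (s + L j) (L j))"
    \<comment> \<open>The flags from the second half on are resampled; the first half does not read
      them.\<close>
    by (intro measure_noise_indep[where J = "{(i, 2 * j + 1) | i. s + L j \<le> i}"] sets.Diff sets.top sets_no_flag)
      (auto simp: override_no_flag)
  also have "\<dots> = x * (1 - x)"
    by (simp only: noise.prob_compl sets_no_flag measure_no_flag x_def)
  finally have "measure noise (space noise - (no_flag j s (L j) - no_flag j (s + L j) (L j))) = 1 - x * (1 - x)"
    by (subst noise.prob_compl) auto
  then show ?thesis
    using x4 by (simp add: bad_block_def Compl_eq_Diff_UNIV)
qed

lemma sets_INT_bad_block: "(\<Inter>r<N. bad_block j (s + 2 * L j * r)) \<in> sets noise" for N :: nat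
proof -
  have "(\<Inter>r<N. bad_block j (s + 2 * L j * r)) = {\<omega>\<in>space noise. \<forall>r\<in>{..<N}. \<omega> \<in> bad_block j (s + 2 * L j * r)}"
    by auto
  then show ?thesis
    using sets_bad_block by (simp only:) (intro sets.sets_Collect_finite_All, auto)
qed

text \<open>Consecutive blocks of length \<open>2 * L j\<close> are disjoint and thus independent:
  each further block contributes a factor \<open>5 / 6\<close>.\<close>

lemma measure_bad_blocks_le:
  "measure noise (\<Inter>r<N. bad_block j (s + 2 * L j * r)) \<le> (5 / 6) ^ N" for N :: nat
proof (induction N)
  case 0
  then show ?case using noise.prob_space by simp
next
  case (Suc N)
  let ?J = "{(i, 2 * j + 1) | i. s + 2 * L j * N \<le> i}"
  have 1: "override_on \<omega> \<omega>' ?J \<in> bad_block j (s + 2 * L j * r) \<longleftrightarrow> \<omega> \<in> bad_block j (s + 2 * L j * r)"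
    if "r < N" for r \<omega> \<omega>'
  proof (rule override_bad_block(1))
    fix i assume "i < s + 2 * L j * r + 2 * L j"
    also have "\<dots> = s + 2 * L j * Suc r" by simp
    also have "\<dots> \<le> s + 2 * L j * N"
      using that by (intro add_left_mono mult_left_mono) auto
    finally show "(i, 2 * j + 1) \<notin> ?J" by auto
  qed
  have 2: "override_on \<omega> \<omega>' ?J \<in> bad_block j (s + 2 * L j * N) \<longleftrightarrow> \<omega>' \<in> bad_block j (s + 2 * L j * N)" for \<omega> \<omega>'
    by (rule override_bad_block(2)) auto
  have "(\<Inter>r<Suc N. bad_block j (s + 2 * L j * r)) = (\<Inter>r<N. bad_block j (s + 2 * L j * r)) \<inter> bad_block j (s + 2 * L j * N)"
    by (auto simp: lessThan_Suc)
  also have "measure noise \<dots> = measure noise (\<Inter>r<N. bad_block j (s + 2 * L j * r)) * measure noise (bad_block j (s + 2 * L j * N))"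
    by (intro measure_noise_indep[where J = ?J] sets_INT_bad_block sets_bad_block 2)
      (simp only: INT_iff, intro ball_cong refl 1, simp)
  also have "\<dots> \<le> (5 / 6) ^ N * (5 / 6)"
    by (intro mult_mono Suc measure_bad_block_le) auto
  finally show ?case by simp
qed

text \<open>The blocks start at \<open>n + L j\<close>, from where on the scale-\<open>j\<close>
  flags are independent of the past.\<close>

lemma measure_past_bad_blocks_le:
  "measure noise (past n h \<inter> (\<Inter>r<N. bad_block j (n + L j + 2 * L j * r)))
     \<le> (5 / 6) ^ N * measure noise (past n h)" for N :: nat
proof -
  have "measure noise (past n h \<inter> (\<Inter>r<N. bad_block j (n + L j + 2 * L j * r)))
      = measure noise (past n h) * measure noise (\<Inter>r<N. bad_block j (n + L j + 2 * L j * r))"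
  proof (rule measure_noise_indep[where J = "{(i, 2 * j + 1) | i. n + L j \<le> i}"])
    show "override_on \<omega> \<omega>' {(i, 2 * j + 1) | i. n + L j \<le> i} \<in> past n h \<longleftrightarrow> \<omega> \<in> past n h" for \<omega> \<omega>'
      by (rule override_past) auto
    show "override_on \<omega> \<omega>' {(i, 2 * j + 1) | i. n + L j \<le> i} \<in> (\<Inter>r<N. bad_block j (n + L j + 2 * L j * r))
      \<longleftrightarrow> \<omega>' \<in> (\<Inter>r<N. bad_block j (n + L j + 2 * L j * r))" for \<omega> \<omega>'
      by (simp add: override_bad_block)
  qed (auto intro: sets_INT_bad_block)
  also have "\<dots> \<le> measure noise (past n h) * (5 / 6) ^ N"
    by (intro mult_left_mono measure_bad_blocks_le) auto
  finally show ?thesis by (simp add: mult.commute)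
qed

lemma good_in_block:
  assumes "\<omega> \<notin> bad_block j s"
  shows "\<exists>m. s + L j \<le> m \<and> m < s + 2 * L j \<and> good j m \<omega>"
proof -
  have empty: "\<And>i. s \<le> i \<Longrightarrow> i < s + L j \<Longrightarrow> \<not> flag j i \<omega>"
    and ex: "\<exists>i. s + L j \<le> i \<and> i < s + L j + L j \<and> flag j i \<omega>"
    using assms by (auto simp: bad_block_def no_flag_def)
  define m where "m = (LEAST i. s + L j \<le> i \<and> i < s + L j + L j \<and> flag j i \<omega>)"
  have m: "s + L j \<le> m" "m < s + L j + L j" "flag j m \<omega>"
    unfolding m_def using LeastI_ex[OF ex] by auto
  \<comment> \<open>From \<open>s + L j \<le> m\<close> and \<open>m < i + L j\<close> it follows
    that \<open>s < i\<close>. So \<open>i\<close> is in the unflagged first half, or in the second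
    half before its first flag.\<close>
  have "\<not> flag j i \<omega>" if "i < m" "m < i + L j" for i
  proof (cases "i < s + L j")
    case True
    then show ?thesis using empty[of i] that m by simp
  next
    case False
    then show ?thesis using not_less_Least[OF that(1)[unfolded m_def]] that m by auto
  qed
  with m show ?thesis by (auto simp: good_def)
qed

text \<open>Either all \<open>N\<close> blocks are bad or some site of the window is good. The
  second case is a union bound: fewer than \<open>2 * L j * N\<close> candidate sites if
  \<open>N > 0\<close>, each flagged with probability \<open>1 / (2 * L j)\<close>, give at most
  \<open>N\<close> expected flags, and each is weighted by the atom bound
  \<open>4 * 2 ^ j / L j\<close>.\<close>

lemma measure_past_sum_le:
  assumes k: "L j + 2 * L j * N \<le> k"
  shows "measure noise (past n h \<inter> {\<omega>. (\<Sum>i=n..<n+k. incr i \<omega>) = y})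
           \<le> ((5 / 6) ^ N + 4 * real N * 2 ^ j / real (L j)) * measure noise (past n h)"
proof -
  let ?bad = "past n h \<inter> (\<Inter>r<N. bad_block j (n + L j + 2 * L j * r))"
  \<comment> \<open>Good sites are sought in second halves of blocks, the first of which begins at
    \<open>n + L j + L j\<close>.\<close>
  let ?T = "{n + 2 * L j..<n + L j + 2 * L j * N}"
  let ?A = "{\<omega>. (\<Sum>i=n..<n+k. incr i \<omega>) = y}"
  have sets_A: "?A \<in> sets noise"
    by (rule sets_noise_Collect) measurable
  have sets_good: "{\<omega>. P j m \<omega>} \<in> sets noise" if "P = good \<or> P = flag" for P m
    using that by (auto intro!: sets_noise_Collect)
  have sub: "past n h \<inter> ?A \<subseteq> ?bad \<union> (\<Union>m\<in>?T. past n h \<inter> {\<omega>. good j m \<omega>} \<inter> ?A)"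
  proof
    fix \<omega> assume \<omega>: "\<omega> \<in> past n h \<inter> ?A"
    show "\<omega> \<in> ?bad \<union> (\<Union>m\<in>?T. past n h \<inter> {\<omega>. good j m \<omega>} \<inter> ?A)"
    proof (cases "\<omega> \<in> ?bad")
      case False
      then obtain r where r: "r < N" "\<omega> \<notin> bad_block j (n + L j + 2 * L j * r)"
        using \<omega> by auto
      from good_in_block[OF r(2)] obtain m where m: "n + L j + 2 * L j * r + L j \<le> m"
        "m < n + L j + 2 * L j * r + 2 * L j" "good j m \<omega>" by blast
      have "m < n + L j + 2 * L j * Suc r" using m by simp
      also have "\<dots> \<le> n + L j + 2 * L j * N"
        using r by (intro add_left_mono mult_left_mono) auto
      finally have "m \<in> ?T" using m by simp
      with m \<omega> show ?thesis by blast
    qed auto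
  qed
  have good_le: "measure noise (past n h \<inter> {\<omega>. good j m \<omega>} \<inter> ?A)
      \<le> 4 * 2 ^ j / real (L j) * (measure noise (past n h) / (2 * real (L j)))" if "m \<in> ?T" for m
  proof -
    have "measure noise (past n h \<inter> {\<omega>. good j m \<omega>} \<inter> ?A)
        \<le> 4 * 2 ^ j / real (L j) * measure noise (past n h \<inter> {\<omega>. good j m \<omega>})"
      using that k by (intro measure_good_sum_le) auto
    also have "\<dots> \<le> 4 * 2 ^ j / real (L j) * measure noise (past n h \<inter> {\<omega>. flag j m \<omega>})"
      by (intro mult_left_mono noise.finite_measure_mono sets.Int sets_past sets_good)
        (auto simp: good_def)
    also have "measure noise (past n h \<inter> {\<omega>. flag j m \<omega>}) = measure noise (past n h) / (2 * real (L j))"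
      using that by (intro measure_past_flag) auto
    finally show ?thesis .
  qed
  have "measure noise (past n h \<inter> ?A)
      \<le> measure noise (?bad \<union> (\<Union>m\<in>?T. past n h \<inter> {\<omega>. good j m \<omega>} \<inter> ?A))"
    using sets_A sets_good sets_INT_bad_block
    by (intro noise.finite_measure_mono sub sets.Un sets.Int sets.finite_UN) auto
  also have "\<dots> \<le> measure noise ?bad + measure noise (\<Union>m\<in>?T. past n h \<inter> {\<omega>. good j m \<omega>} \<inter> ?A)"
    using sets_A sets_good sets_INT_bad_block
    by (intro measure_Un_le sets.Int sets.finite_UN) auto
  also have "measure noise (\<Union>m\<in>?T. past n h \<inter> {\<omega>. good j m \<omega>} \<inter> ?A)
      \<le> (\<Sum>m\<in>?T. measure noise (past n h \<inter> {\<omega>. good j m \<omega>} \<inter> ?A))"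
    using sets_A sets_good by (intro measure_UNION_le sets.Int) auto
  also have "\<dots> \<le> (\<Sum>m\<in>?T. 4 * 2 ^ j / real (L j) * (measure noise (past n h) / (2 * real (L j))))"
    by (intro sum_mono good_le)
  also have "\<dots> = real (card ?T) * (4 * 2 ^ j / real (L j) * (measure noise (past n h) / (2 * real (L j))))"
    by simp
  also have "\<dots> \<le> real (2 * L j * N) * (4 * 2 ^ j / real (L j) * (measure noise (past n h) / (2 * real (L j))))"
    by (intro mult_right_mono of_nat_mono) auto
  also have "\<dots> = 4 * real N * 2 ^ j / real (L j) * measure noise (past n h)"
    using L_pos[of j] by (simp add: field_simps)
  also have "measure noise ?bad \<le> (5 / 6) ^ N * measure noise (past n h)"
    by (rule measure_past_bad_blocks_le)
  finally show ?thesis by (simp add: algebra_simps)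
qed

end

section \<open>Stationarity and ergodicity\<close>

text \<open>An event unaffected by finite changes is independent of every cylinder. Hence the noise
  restricted to \<open>E\<close> is a multiple of the noise itself, and evaluating both at
  \<open>E\<close> shows that the probability equals its square.\<close>

lemma noise_zero_one_law:
  assumes E: "E \<in> sets noise"
    and inv: "\<And>I \<omega> \<omega>'. finite I \<Longrightarrow> override_on \<omega> \<omega>' I \<in> E \<longleftrightarrow> \<omega> \<in> E"
  shows "measure noise E \<in> {0, 1}"
proof -
  have "density noise (indicator E) = scale_measure (ennreal (measure noise E)) noise"
  proof (rule noise_eqI)
    fix I :: "'a set" and B :: "'a \<Rightarrow> real set"
    assume I: "finite I" "\<And>i. i \<in> I \<Longrightarrow> B i \<in> sets borel"
    let ?C = "{\<omega>. \<forall>i\<in>I. \<omega> i \<in> B i}"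
    have C: "?C \<in> sets noise" using I by (rule sets_noise_cylinder)
    have "measure noise (E \<inter> ?C) = measure noise E * measure noise ?C"
      using E C inv[OF I(1)] by (rule measure_noise_indep) (auto simp: override_on_def)
    then show "emeasure (density noise (indicator E)) ?C
        = emeasure (scale_measure (ennreal (measure noise E)) noise) ?C"
      using E C by (simp add: emeasure_restricted noise.emeasure_eq_measure ennreal_mult)
  next
    have "emeasure (density noise (indicator E)) UNIV = emeasure noise (E \<inter> UNIV)"
      using E sets.top[of noise] by (intro emeasure_restricted) auto
    then show "finite_measure (density noise (indicator E))"
      by (intro finite_measureI) simp
  qed auto
  then have "emeasure (density noise (indicator E)) E = emeasure (scale_measure (ennreal (measure noise E)) noise) E"
    by simp
  then have "measure noise E = measure noise E * measure noise E"
    using E by (simp add: emeasure_restricted noise.emeasure_eq_measure flip: ennreal_mult)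
  then show ?thesis by auto
qed

lemma distr_noise_reindex:
  fixes f :: "'i \<Rightarrow> 'i"
  assumes "inj f"
  shows "distr noise noise (\<lambda>\<omega> i. \<omega> (f i)) = noise"
  using distr_PiM_reindex[of UNIV "\<lambda>_. unif" f UNIV] assms prob_space_unif
  by (simp add: noise_def restrict_def)

section \<open>From increment sequences to walks\<close>

lemma partial_sums_eq_iff:
  fixes x s :: "nat \<Rightarrow> int"
  shows "(\<forall>i\<le>n. (\<Sum>l<i. x l) = s i) \<longleftrightarrow> s 0 = 0 \<and> (\<forall>i<n. x i = s (Suc i) - s i)"
proof (induction n)
  case (Suc n)
  have "(\<forall>i\<le>Suc n. (\<Sum>l<i. x l) = s i) \<longleftrightarrow> (\<forall>i\<le>n. (\<Sum>l<i. x l) = s i) \<and> (\<Sum>l<Suc n. x l) = s (Suc n)"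
    by (auto simp: le_Suc_eq simp del: sum.lessThan_Suc)
  also have "\<dots> \<longleftrightarrow> (\<forall>i\<le>n. (\<Sum>l<i. x l) = s i) \<and> x n = s (Suc n) - s n"
    by (intro conj_cong refl) auto
  finally show ?case using Suc by (auto simp: less_Suc_eq)
qed auto

text \<open>If the condition has measure 0, the quotient is 0 by convention and
  \<open>0 \<le> c\<close> settles the claim.\<close>

lemma cond_prob_leI:
  assumes "measure M {x\<in>space M. P x \<and> Q x} \<le> c * measure M {x\<in>space M. Q x}" "0 \<le> c"
  shows "cond_prob M P Q \<le> c"
proof (cases "measure M {x\<in>space M. Q x} = 0")
  case False
  then have "0 < measure M {x\<in>space M. Q x}" by (simp add: zero_less_measure_iff)
  then show ?thesis
    using assms by (simp add: cond_prob_def pos_divide_le_eq)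
qed (use assms in \<open>simp add: cond_prob_def\<close>)

text \<open>Sample points are the increment sequences themselves, so the increment process is the
  coordinate process and its law is the underlying measure.\<close>

definition walk :: "nat \<Rightarrow> (nat \<Rightarrow> int) \<Rightarrow> int" where
  "walk n x = (\<Sum>i<n. x i)"

lemma increments_walk: "increments walk n x = x n"
  by (simp add: increments_def walk_def)

abbreviation seqs :: "(nat \<Rightarrow> int) measure" where
  "seqs \<equiv> \<Pi>\<^sub>M i\<in>UNIV. count_space UNIV"

lemma measurable_walk [measurable]: "walk n \<in> seqs \<rightarrow>\<^sub>M count_space UNIV"
  unfolding walk_def by measurable

context multiscale
begin

definition law :: "(nat \<Rightarrow> int) measure" where
  "law = distr noise seqs (\<lambda>\<omega> i. incr i \<omega>)"

lemma measurable_incrs [measurable]: "(\<lambda>\<omega> i. incr i \<omega>) \<in> noise \<rightarrow>\<^sub>M seqs"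
  by (rule measurable_PiM_single') auto

lemma sets_law [simp, measurable_cong]: "sets law = sets seqs"
  by (simp add: law_def)

lemma space_law [simp]: "space law = UNIV"
  by (simp add: law_def space_PiM)

lemma prob_space_law: "prob_space law"
  unfolding law_def by (rule noise.prob_space_distr) measurable

lemma measurable_walk_law: "walk n \<in> law \<rightarrow>\<^sub>M count_space UNIV"
  unfolding law_def by measurable

lemma measure_law: "Measurable.pred seqs P \<Longrightarrow> measure law {x. P x} = measure noise {\<omega>. P (\<lambda>i. incr i \<omega>)}"
  unfolding law_def by (subst measure_distr) (auto simp: pred_def space_PiM vimage_def)

lemma nearest_neighbour_law: "nearest_neighbour law walk"
  unfolding nearest_neighbour_def
proof (intro allI impI)
  fix n :: nat assume "1 \<le> n"
  then obtain l where "n = Suc l" by (cases n) auto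
  moreover have "AE x in law. \<bar>x l\<bar> = 1"
    unfolding law_def by (subst AE_distr_iff[OF measurable_incrs]) (measurable, simp add: incr_def)
  ultimately show "AE x in law. \<bar>walk n x - walk (n - 1) x\<bar> = 1"
    by (simp add: walk_def)
qed

lemma process_law_increments: "process_law law (increments walk) = law"
  unfolding process_law_def increments_walk
  by (rule distr_id2) simp

text \<open>The construction reads the noise only at positions relative to the site, hence commutes
  with the shift of sites.\<close>

lemma incr_Suc: "incr (Suc i) \<omega> = incr i (\<lambda>(i, c). \<omega> (Suc i, c))"
proof -
  have "first_value j l (Suc i) \<omega> = first_value j l i (\<lambda>(i, c). \<omega> (Suc i, c))" for j l i
    by (induction l arbitrary: i) (auto simp: flag_def)
  then show ?thesis by (simp add: incr_def bias_def)
qed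

text \<open>Shifting the increments equals shifting the sites of the noise, an injective reindexing
  of identically distributed independent coordinates.\<close>

lemma stationary_law: "stationary_process law (increments walk)"
proof -
  define f where "f = (\<lambda>(i :: nat, c :: nat). (Suc i, c))"
  have "inj f" by (auto simp: f_def inj_def)
  have m: "(\<lambda>\<omega> i. \<omega> (f i)) \<in> noise \<rightarrow>\<^sub>M noise"
    unfolding measurable_cong_sets[OF refl sets_noise] by (rule measurable_PiM_single') auto
  have "process_law law (\<lambda>n. increments walk (Suc n)) = distr law seqs (\<lambda>x n. x (Suc n))"
    by (simp add: process_law_def increments_walk)
  also have "\<dots> = distr noise seqs (\<lambda>\<omega> i. incr (Suc i) \<omega>)"
    unfolding law_def by (subst distr_distr) (auto simp: o_def intro!: measurable_PiM_single')
  also have "\<dots> = distr noise seqs ((\<lambda>\<omega> i. incr i \<omega>) \<circ> (\<lambda>\<omega> i. \<omega> (f i)))"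
    unfolding incr_Suc by (rule arg_cong[where f = "distr noise seqs"]) (auto simp: f_def o_def case_prod_unfold)
  also have "\<dots> = distr (distr noise noise (\<lambda>\<omega> i. \<omega> (f i))) seqs (\<lambda>\<omega> i. incr i \<omega>)"
    using m by (subst distr_distr) auto
  also have "\<dots> = law"
    by (simp add: distr_noise_reindex[OF \<open>inj f\<close>] law_def)
  finally show ?thesis
    by (simp add: stationary_process_def process_law_increments)
qed

text \<open>A shift-invariant event is decided by the increments from any \<open>n\<close> on, and
  these read no noise before site \<open>n\<close>. Its pullback to the noise is thus insensitive to
  finite changes, and the zero-one law applies.\<close>

lemma ergodic_law: "ergodic_process law (increments walk)"
  unfolding ergodic_process_def process_law_increments
proof (intro ballI impI)
  fix A assume A: "A \<in> sets law" and inv: "shift -` A = A"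
  have shift: "(\<lambda>i. x (i + n)) \<in> A \<longleftrightarrow> x \<in> A" for x n
  proof (induction n)
    case (Suc n)
    have "(\<lambda>i. x (i + Suc n)) = shift (\<lambda>i. x (i + n))"
      by (simp add: shift_def)
    then show ?case using Suc inv by (metis vimage_eq)
  qed simp
  define E where "E = {\<omega>. (\<lambda>i. incr i \<omega>) \<in> A}"
  have E: "E \<in> sets noise"
    using measurable_sets[OF measurable_incrs, of A] A by (simp add: E_def vimage_def)
  have "override_on \<omega> \<omega>' I \<in> E \<longleftrightarrow> \<omega> \<in> E" if "finite I" for I \<omega> \<omega>'
  proof -
    obtain n where n: "\<And>i. i \<in> fst ` I \<Longrightarrow> i < n"
      using finite_nat_set_iff_bounded[of "fst ` I"] \<open>finite I\<close> by blast
    then have "(i, c) \<notin> I" if "n \<le> i" for i c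
      using that by force
    then have "incr (i + n) (override_on \<omega> \<omega>' I) = incr (i + n) \<omega>" for i
      by (intro incr_cong) (auto simp: override_on_def)
    then show ?thesis
      using shift[of "\<lambda>i. incr i \<omega>" n] shift[of "\<lambda>i. incr i (override_on \<omega> \<omega>' I)" n]
      by (simp add: E_def)
  qed
  then have "measure noise E \<in> {0, 1}"
    by (intro noise_zero_one_law E)
  moreover have "measure law A = measure noise E"
    using A unfolding law_def by (subst measure_distr) (auto simp: E_def vimage_def)
  ultimately show "measure law A \<in> {0, 1}" by simp
qed

section \<open>The predictability profile of the walk\<close>

lemma cond_prob_walk_le:
  assumes "L j + 2 * L j * N \<le> k"
  shows "cond_prob law (\<lambda>x. walk (n + k) x = y) (\<lambda>x. \<forall>i\<le>n. walk i x = s i)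
           \<le> (5 / 6) ^ N + 4 * real N * 2 ^ j / real (L j)" (is "_ \<le> ?c")
proof (cases "s 0 = 0")
  case True
  define h where "h i = s (Suc i) - s i" for i
  have past: "(\<forall>i\<le>n. walk i (\<lambda>i. incr i \<omega>) = s i) \<longleftrightarrow> \<omega> \<in> past n h" for \<omega>
    using True by (simp add: walk_def partial_sums_eq_iff past_def h_def)
  then have walk_n: "walk n (\<lambda>i. incr i \<omega>) = s n" if "\<omega> \<in> past n h" for \<omega>
    using that by blast
  have walk_add: "walk (n + k) x = walk n x + (\<Sum>i=n..<n+k. x i)" for x
    unfolding walk_def by (simp add: lessThan_atLeast0 sum.atLeastLessThan_concat)
  have "measure law {x. walk (n + k) x = y \<and> (\<forall>i\<le>n. walk i x = s i)}
      = measure noise {\<omega>. walk (n + k) (\<lambda>i. incr i \<omega>) = y \<and> (\<forall>i\<le>n. walk i (\<lambda>i. incr i \<omega>) = s i)}"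
    by (rule measure_law) measurable
  also have "{\<omega>. walk (n + k) (\<lambda>i. incr i \<omega>) = y \<and> (\<forall>i\<le>n. walk i (\<lambda>i. incr i \<omega>) = s i)}
      = past n h \<inter> {\<omega>. (\<Sum>i=n..<n+k. incr i \<omega>) = y - s n}"
  proof -
    have "walk (n + k) (\<lambda>i. incr i \<omega>) = y \<and> \<omega> \<in> past n h \<longleftrightarrow> \<omega> \<in> past n h \<and> (\<Sum>i=n..<n+k. incr i \<omega>) = y - s n" for \<omega>
      using walk_n[of \<omega>] unfolding walk_add by linarith
    then show ?thesis
      unfolding past by (simp only: Int_def mem_Collect_eq)
  qed
  also have "measure noise \<dots> \<le> ?c * measure noise (past n h)"
    by (rule measure_past_sum_le[OF assms])
  also have "measure noise (past n h) = measure law {x. \<forall>i\<le>n. walk i x = s i}"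
    by (subst measure_law) (measurable, simp add: past)
  finally show ?thesis
    by (intro cond_prob_leI) simp_all
next
  case False
  \<comment> \<open>The walk starts at 0, so this history is impossible and the conditional
    probability is 0 by convention.\<close>
  then have "\<not> (\<forall>i\<le>n. walk i x = s i)" for x
    by (auto simp: walk_def intro!: exI[of _ 0])
  then have *: "(\<lambda>x. \<forall>i\<le>n. walk i x = s i) = (\<lambda>x. False)"
    by (intro ext) blast
  show ?thesis
    unfolding * by (simp add: cond_prob_def)
qed

lemma predictability_profile_leI:
  assumes "\<And>y n s. cond_prob law (\<lambda>x. walk (n + k) x = y) (\<lambda>x. \<forall>i\<le>n. walk i x = s i) \<le> c"
  shows "predictability_profile law walk k \<le> c"
  unfolding predictability_profile_def
proof (rule cSup_least)
  let ?S = "{cond_prob law (\<lambda>x. walk (n + k) x = y) (\<lambda>x. \<forall>i\<le>n. walk i x = s i) | y n s.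
      \<P>(x in law. \<forall>i\<le>n. walk i x = s i) > 0}"
  \<comment> \<open>The trivial history at time 0 is certain, so the supremum is over a nonempty
    set.\<close>
  have "\<P>(x in law. \<forall>i\<le>0. walk i x = 0) > 0"
    using prob_space.prob_space[OF prob_space_law] by (simp add: walk_def)
  then have "cond_prob law (\<lambda>x. walk (0 + k) x = 0) (\<lambda>x. \<forall>i\<le>0. walk i x = 0) \<in> ?S"
    by (intro CollectI exI[of _ 0] exI[of _ "\<lambda>_. 0"] conjI refl)
  then show "?S \<noteq> {}" by (metis empty_iff)
next
  fix z assume "z \<in> {cond_prob law (\<lambda>x. walk (n + k) x = y) (\<lambda>x. \<forall>i\<le>n. walk i x = s i) | y n s.
      \<P>(x in law. \<forall>i\<le>n. walk i x = s i) > 0}"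
  then show "z \<le> c"
    by (elim CollectE exE conjE) (simp only: assms)
qed

lemma predictability_profile_le:
  assumes "L j + 2 * L j * N \<le> k"
  shows "predictability_profile law walk k \<le> (5 / 6) ^ N + 4 * real N * 2 ^ j / real (L j)"
  by (intro predictability_profile_leI cond_prob_walk_le assms)

lemma predictability_profile_le_1: "predictability_profile law walk k \<le> 1"
proof (rule predictability_profile_leI)
  interpret law: prob_space law by (rule prob_space_law)
  fix y n s
  have "measure law {x. walk (n + k) x = y \<and> (\<forall>i\<le>n. walk i x = s i)} \<le> measure law {x. \<forall>i\<le>n. walk i x = s i}"
  proof (rule law.finite_measure_mono)
    have "{x\<in>space law. \<forall>i\<le>n. walk i x = s i} \<in> sets law"
      unfolding law_def by measurable
    then show "{x. \<forall>i\<le>n. walk i x = s i} \<in> sets law" by simp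
  qed auto
  then show "cond_prob law (\<lambda>x. walk (n + k) x = y) (\<lambda>x. \<forall>i\<le>n. walk i x = s i) \<le> 1"
    by (intro cond_prob_leI) simp_all
qed

end

section \<open>Choice of the scales\<close>

text \<open>Used with \<open>n = 2 ^ j\<close> to trade the doubly exponential
  \<open>(5 / 6) ^ (2 ^ j)\<close> for a negative power of \<open>2 ^ j\<close>.\<close>

lemma power_times_geometric_bounded:
  obtains C :: real where "\<And>n :: nat. real n ^ m * (5 / 6) ^ n \<le> C"
proof -
  have "(\<lambda>n. real n ^ m * (5 / 6) ^ n) \<longlonglongrightarrow> 0"
    by real_asymp
  then have "Bseq (\<lambda>n. real n ^ m * (5 / 6) ^ n)"
    by (intro convergent_imp_Bseq convergentI)
  then obtain C where "\<And>n. norm (real n ^ m * (5 / 6) ^ n) \<le> C"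
    unfolding Bseq_def by blast
  then show ?thesis by (intro that[of C]) (auto dest: abs_le_D1)
qed

text \<open>The thresholds start at 3 and are unbounded, so \<open>k\<close> falls between two
  consecutive ones; they will bound the window length at scale \<open>j\<close>.\<close>

lemma ex_scale:
  fixes k R :: nat
  assumes "3 \<le> k" "0 < R"
  obtains j where "3 * 2 ^ (R * j) \<le> k" "k < 3 * 2 ^ (R * Suc j)"
proof -
  have "k < 2 ^ k" by (rule less_exp)
  also have "(2 :: nat) ^ k \<le> 2 ^ (R * k)" using assms by (intro power_increasing) auto
  finally have k: "k < 3 * 2 ^ (R * k)" by linarith
  have "\<not> k < 3 * 2 ^ (R * 0)" using assms by simp
  from ex_least_nat_less[of "\<lambda>j. k < 3 * 2 ^ (R * j)", OF k this]
  obtain j where j: "\<forall>i\<le>j. \<not> k < 3 * 2 ^ (R * i)" "k < 3 * 2 ^ (R * Suc j)"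
    unfolding Suc_eq_plus1 by (elim exE conjE)
  show ?thesis
    using j(1)[THEN spec, of j] j(2) by (intro that[of j]) (simp_all only: not_less order_refl simp_thms)
qed

lemma ex_unpredictable_walk:
  assumes "\<alpha> < 1"
  shows "\<exists>M (S :: nat \<Rightarrow> (nat \<Rightarrow> int) \<Rightarrow> int). unpredictable_walk \<alpha> M S \<and>
           stationary_process M (increments S) \<and> ergodic_process M (increments S)"
proof -
  \<comment> \<open>A nonnegative exponent makes \<open>powr \<beta>\<close> monotone, and a bound
    with \<open>\<beta>\<close> implies the one with \<open>\<alpha>\<close>.\<close>
  define \<beta> where "\<beta> = max \<alpha> 0"
  have \<beta>: "0 \<le> \<beta>" "\<beta> < 1" "\<alpha> \<le> \<beta>" using assms by (auto simp: \<beta>_def)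
  \<comment> \<open>\<open>R\<close> is chosen so that \<open>(R + 1) * \<beta> \<le> R - 2\<close>:
    windows have length of order \<open>2 ^ ((R + 1) * j)\<close>, while the bound at scale
    \<open>j\<close> decays like \<open>2 ^ ((R - 2) * j)\<close>.\<close>
  define R where "R = nat \<lceil>3 / (1 - \<beta>)\<rceil>"
  have "3 / (1 - \<beta>) \<le> real R" unfolding R_def by linarith
  then have "3 \<le> real R * (1 - \<beta>)" using \<beta> by (simp add: field_simps)
  then have R: "real (R + 1) * \<beta> \<le> real R - 2" using \<beta> by (simp add: algebra_simps)
  have "3 \<le> R"
  proof -
    have "real R * (1 - \<beta>) \<le> real R" using \<beta> by (intro mult_left_le) auto
    with \<open>3 \<le> real R * (1 - \<beta>)\<close> show ?thesis by linarith
  qed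
  define L :: "nat \<Rightarrow> nat" where "L j = 2 ^ (R * j)" for j
  interpret multiscale L by unfold_locales (simp add: L_def)
  obtain C where C: "\<And>n. real n ^ (R - 2) * (5 / 6) ^ n \<le> C"
    using power_times_geometric_bounded[of "R - 2"] by auto
  have "0 \<le> C" using C[of 1] by simp
  \<comment> \<open>\<open>D\<close> pays for the constant 3 and for the gap between
    \<open>k\<close> and the next threshold, a factor of \<open>2 ^ (R + 1)\<close>.\<close>
  define D where "D = (3 * 2 ^ (R + 1)) powr \<beta>"
  have D: "3 powr \<beta> \<le> D" "0 \<le> D"
    unfolding D_def using \<beta> one_le_power[of "2 :: real" "R + 1"] by (auto intro!: powr_mono2)
  have bound: "predictability_profile law walk k \<le> (C + 5) * D * real k powr - \<alpha>" if "1 \<le> k" for k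
  proof -
    have mono: "real k powr - \<beta> \<le> real k powr - \<alpha>"
      using \<beta> that by (intro powr_mono) auto
    have "predictability_profile law walk k \<le> (C + 5) * D * real k powr - \<beta>"
    proof (cases "k < 3")
      \<comment> \<open>No scale fits below 3, but there the trivial bound 1 suffices.\<close>
      case True
      have "1 = real k powr \<beta> * real k powr - \<beta>"
        using that by (simp flip: powr_add)
      also have "\<dots> \<le> D * real k powr - \<beta>"
        using True \<beta> that D by (intro mult_right_mono order_trans[OF powr_mono2 D(1)]) auto
      also have "\<dots> \<le> (C + 5) * (D * real k powr - \<beta>)"
        using \<open>0 \<le> C\<close> D mult_right_mono[of 1 "C + 5" "D * real k powr - \<beta>"] by simp
      finally show ?thesis
        using predictability_profile_le_1[of k] by (simp add: mult.assoc)
    next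
      case False
      then have "3 \<le> k" "0 < R + 1" by auto
      from ex_scale[OF this]
      obtain j where j: "3 * 2 ^ ((R + 1) * j) \<le> k" "k < 3 * 2 ^ ((R + 1) * Suc j)" .
      define u :: real where "u = 2 ^ ((R - 2) * j)"
      have u: "0 < u" "real (2 ^ j) ^ (R - 2) = u"
        by (auto simp: u_def mult.commute simp flip: power_mult)
      \<comment> \<open>With \<open>N = 2 ^ j\<close> blocks the window is at most
        \<open>3 * L j * 2 ^ j\<close>, which is the lower threshold for \<open>k\<close>.\<close>
      have "L j * 1 \<le> L j * 2 ^ j"
        by (intro mult_left_mono) auto
      moreover have "2 ^ ((R + 1) * j) = L j * 2 ^ j"
        by (simp add: L_def power_add)
      ultimately have "L j + 2 * L j * 2 ^ j \<le> k" using j(1) by (simp only: mult_1_right mult.assoc)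
      then have "predictability_profile law walk k \<le> (5 / 6) ^ (2 ^ j) + 4 * real (2 ^ j) * 2 ^ j / real (L j)"
        by (rule predictability_profile_le)
      also have "(5 / 6) ^ (2 ^ j) \<le> C / u"
        using C[of "2 ^ j"] u by (simp add: field_simps)
      also have "4 * real (2 ^ j) * 2 ^ j / real (L j) = 4 / u"
      proof -
        have "R * j = (R - 2) * j + j + j"
          using \<open>3 \<le> R\<close> by (simp add: algebra_simps diff_mult_distrib)
        then have "real (L j) = u * 2 ^ j * 2 ^ j"
          by (simp add: L_def u_def power_add)
        then show ?thesis by simp
      qed
      also have "C / u + 4 / u \<le> (C + 5) / u"
        using u by (simp add: field_simps)
      also have "1 / u \<le> D * real k powr - \<beta>"
      proof -
        have "real k powr \<beta> \<le> (3 * 2 ^ (R + 1) * 2 ^ ((R + 1) * j)) powr \<beta>"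
        proof (rule powr_mono2)
          have "real k \<le> real (3 * 2 ^ ((R + 1) * Suc j))" using j by linarith
          then show "real k \<le> 3 * 2 ^ (R + 1) * 2 ^ ((R + 1) * j)"
            by (simp add: power_add)
        qed (use \<beta> in auto)
        also have "\<dots> = D * (2 ^ ((R + 1) * j)) powr \<beta>"
          by (simp add: D_def powr_mult)
        also have "(2 ^ ((R + 1) * j)) powr \<beta> = 2 powr (real (R + 1) * \<beta> * real j)"
          by (subst powr_realpow[symmetric]) (simp_all add: powr_powr algebra_simps)
        also have "\<dots> \<le> 2 powr ((real R - 2) * real j)"
          using R by (intro powr_mono mult_right_mono) auto
        also have "\<dots> = u"
          using \<open>3 \<le> R\<close> unfolding u_def by (subst powr_realpow[symmetric]) (simp_all add: of_nat_diff)
        finally have "real k powr \<beta> \<le> D * u" using D by (simp add: mult_left_mono)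
        then show ?thesis
          using u that by (simp add: powr_minus field_simps)
      qed
      then have "(C + 5) / u \<le> (C + 5) * (D * real k powr - \<beta>)"
        using mult_left_mono[of "1 / u" "D * real k powr - \<beta>" "C + 5"] \<open>0 \<le> C\<close> by simp
      finally show ?thesis by (simp add: mult.assoc)
    qed
    also have "\<dots> \<le> (C + 5) * D * real k powr - \<alpha>"
      using mono \<open>0 \<le> C\<close> D by (intro mult_left_mono) auto
    finally show ?thesis .
  qed
  have "unpredictable_walk \<alpha> law walk"
    unfolding unpredictable_walk_def discrete_process_def
    using prob_space_law measurable_walk_law nearest_neighbour_law bound by blast
  then show ?thesis
    using stationary_law ergodic_law by blast
qed

theorem theorem1p1:
  shows "(\<forall>\<alpha>::real. \<alpha> < 1 \<longrightarrow>
            (\<exists>(M :: (nat \<Rightarrow> int) measure) (S :: nat \<Rightarrow> (nat \<Rightarrow> int) \<Rightarrow> int).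
               unpredictable_walk \<alpha> M S)) \<and>
         (\<forall>\<alpha>::real. \<alpha> < 1 \<longrightarrow>
            (\<exists>(M :: (nat \<Rightarrow> int) measure) (S :: nat \<Rightarrow> (nat \<Rightarrow> int) \<Rightarrow> int).
               unpredictable_walk \<alpha> M S \<and>
               stationary_process M (increments S) \<and> ergodic_process M (increments S)))"
  using ex_unpredictable_walk by blast

end
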